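(* Every algebraically subelliptic algebraic manifold is strongly algebraically dominable.
   Context: An algebraic manifold is a smooth algebraic variety over $\mathbb{C}$, quasi-compact in the Zariski topology. An algebraic spray on an algebraic manifold $Y$ is a triple $(E,\pi,s)$, where $\pi:E\to Y$ is an algebraic vector bundle and $s:E\to Y$ is a regular map with $s(0_y)=y$ for all $y\in Y$, where $0_y$ is the zero of the fibre $E_y$. A family of algebraic sprays $(E_j,\pi_j,s_j)$, $j=1,\ldots,m$, on $Y$ is dominating if for every $y\in Y$, $\sum_{j=1}^m d_{0_y}s_j(E_{j,y})=T_yY$, where the fibre $E_{j,y}$ is identified with the subspace of $T_{0_y}E_j$ of vectors tangent to the fibre. An algebraic manifold is algebraically subelliptic if it has a finite dominating family of algebraic sprays. An algebraic manifold $X$ is algebraically dominable at a point $x\in X$ if there is a regular map $f:\mathbb{C}^n\to X$, $n=\dim X$, such that $f(0)=x$ and $f$ is a local isomorphism at $0$ (in the analytic sense, equivalently, the differential $d_0f:T_0\mathbb{C}^n\to T_xX$ is an isomorphism). It is strongly algebraically dominable if it is algebraically dominable at every point. *)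

theory Defs
  imports
    "HOL-Analysis.Analysis"
    "HOL-Library.Function_Algebras"
    "HOL-Library.Extended_Nat"
begin

section \<open>Complex-valued functions as a complex vector space\<close>

definition cscale :: "complex \<Rightarrow> ('b \<Rightarrow> complex) \<Rightarrow> 'b \<Rightarrow> complex" where
  "cscale c f = (\<lambda>x. c * f x)"

global_interpretation cfun: vector_space cscale
  by standard (auto simp: cscale_def fun_eq_iff algebra_simps)

section \<open>Spaces with functions\<close>

text \<open>
  A variety is treated as a topological space together with, for every open set \<open>U\<close>, the
  set of regular functions on \<open>U\<close>. Functions are total in HOL; only the values on \<open>U\<close> matter,
  and \<open>reg X U\<close> is meaningful for open \<open>U\<close> only.
\<close>

record 'a fspace =
  zar :: "'a topology"
  reg :: "'a set \<Rightarrow> ('a \<Rightarrow> complex) set"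

abbreviation points :: "'a fspace \<Rightarrow> 'a set" where
  "points X \<equiv> topspace (zar X)"

definition space_with_functions :: "'a fspace \<Rightarrow> bool" where
  "space_with_functions X \<longleftrightarrow>
     (\<forall>U f g. openin (zar X) U \<longrightarrow> f \<in> reg X U \<longrightarrow> (\<forall>x\<in>U. g x = f x) \<longrightarrow> g \<in> reg X U) \<and>
     (\<forall>U c. openin (zar X) U \<longrightarrow> (\<lambda>_. c) \<in> reg X U) \<and>
     (\<forall>U f g. openin (zar X) U \<longrightarrow> f \<in> reg X U \<longrightarrow> g \<in> reg X U \<longrightarrow>
        f + g \<in> reg X U \<and> f * g \<in> reg X U) \<and>
     (\<forall>U f. openin (zar X) U \<longrightarrow> f \<in> reg X U \<longrightarrow>
        openin (zar X) {x \<in> U. f x \<noteq> 0} \<and> (\<lambda>x. 1 / f x) \<in> reg X {x \<in> U. f x \<noteq> 0}) \<and>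
     (\<forall>U V f. openin (zar X) U \<longrightarrow> openin (zar X) V \<longrightarrow> V \<subseteq> U \<longrightarrow> f \<in> reg X U \<longrightarrow> f \<in> reg X V) \<and>
     (\<forall>U f. openin (zar X) U \<longrightarrow>
        (\<forall>x\<in>U. \<exists>V. openin (zar X) V \<and> x \<in> V \<and> V \<subseteq> U \<and> f \<in> reg X V) \<longrightarrow> f \<in> reg X U)"

definition morphism :: "'a fspace \<Rightarrow> 'b fspace \<Rightarrow> ('a \<Rightarrow> 'b) \<Rightarrow> bool" where
  "morphism X Y f \<longleftrightarrow>
     continuous_map (zar X) (zar Y) f \<and>
     (\<forall>V g. openin (zar Y) V \<longrightarrow> g \<in> reg Y V \<longrightarrow> g \<circ> f \<in> reg X {x \<in> points X. f x \<in> V})"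

definition isomorphism :: "'a fspace \<Rightarrow> 'b fspace \<Rightarrow> ('a \<Rightarrow> 'b) \<Rightarrow> bool" where
  "isomorphism X Y f \<longleftrightarrow>
     morphism X Y f \<and>
     (\<exists>g. morphism Y X g \<and> (\<forall>x\<in>points X. g (f x) = x) \<and> (\<forall>y\<in>points Y. f (g y) = y))"

text \<open>Only used for open \<open>U\<close>.\<close>

definition restrict_fspace :: "'a fspace \<Rightarrow> 'a set \<Rightarrow> 'a fspace" where
  "restrict_fspace X U = \<lparr>zar = subtopology (zar X) U, reg = reg X\<rparr>"

section \<open>Affine varieties\<close>

text \<open>Affine \<open>n\<close>-space consists of the sequences supported on the indices below \<open>n\<close>.\<close>

definition affine_points :: "nat \<Rightarrow> (nat \<Rightarrow> complex) set" where
  "affine_points n = {z. \<forall>i\<ge>n. z i = 0}"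

inductive_set poly_fun :: "nat \<Rightarrow> ((nat \<Rightarrow> complex) \<Rightarrow> complex) set" for n :: nat where
  const: "(\<lambda>_. c) \<in> poly_fun n"
| coord: "i < n \<Longrightarrow> (\<lambda>z. z i) \<in> poly_fun n"
| add: "p \<in> poly_fun n \<Longrightarrow> q \<in> poly_fun n \<Longrightarrow> (\<lambda>z. p z + q z) \<in> poly_fun n"
| mult: "p \<in> poly_fun n \<Longrightarrow> q \<in> poly_fun n \<Longrightarrow> (\<lambda>z. p z * q z) \<in> poly_fun n"

text \<open>
  The principal open sets are closed under finite intersections, so they form a base and the
  closed sets are exactly the common zero sets of sets of polynomials.
\<close>

definition zariski :: "nat \<Rightarrow> (nat \<Rightarrow> complex) topology" where
  "zariski n = topology_generated_by {{z \<in> affine_points n. p z \<noteq> 0} |p. p \<in> poly_fun n}"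

text \<open>\<open>Z\<close> is meant to be a Zariski closed subset of affine \<open>n\<close>-space.\<close>

definition affine_variety :: "nat \<Rightarrow> (nat \<Rightarrow> complex) set \<Rightarrow> (nat \<Rightarrow> complex) fspace" where
  "affine_variety n Z =
     \<lparr>zar = subtopology (zariski n) Z,
      reg = (\<lambda>U. {f. \<forall>x\<in>U. \<exists>W. \<exists>p\<in>poly_fun n. \<exists>q\<in>poly_fun n.
               openin (subtopology (zariski n) Z) W \<and> x \<in> W \<and> W \<subseteq> U \<and>
               (\<forall>z\<in>W. q z \<noteq> 0 \<and> f z = p z / q z)})\<rparr>"

definition affine_space :: "nat \<Rightarrow> (nat \<Rightarrow> complex) fspace" where
  "affine_space n = affine_variety n (affine_points n)"

section \<open>Products\<close>

definition tensor_functions ::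
  "'a fspace \<Rightarrow> 'b fspace \<Rightarrow> 'a set \<Rightarrow> 'b set \<Rightarrow> ('a \<times> 'b \<Rightarrow> complex) set" where
  "tensor_functions X Y U V =
     {(\<lambda>(x, y). \<Sum>i<k. f i x * g i y) | (k::nat) f g. \<forall>i<k. f i \<in> reg X U \<and> g i \<in> reg Y V}"

text \<open>
  The product in the category of spaces with functions. Its topology is the Zariski topology of
  the product variety, which is in general finer than the product topology.
\<close>

definition prod_zariski :: "'a fspace \<Rightarrow> 'b fspace \<Rightarrow> ('a \<times> 'b) topology" where
  "prod_zariski X Y = topology_generated_by
     {{w \<in> U \<times> V. h w \<noteq> 0} |U V h.
        openin (zar X) U \<and> openin (zar Y) V \<and> h \<in> tensor_functions X Y U V}"

definition prod_fspace :: "'a fspace \<Rightarrow> 'b fspace \<Rightarrow> ('a \<times> 'b) fspace" where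
  "prod_fspace X Y =
     \<lparr>zar = prod_zariski X Y,
      reg = (\<lambda>D. {f. \<forall>w\<in>D. \<exists>U V W. \<exists>a\<in>tensor_functions X Y U V. \<exists>b\<in>tensor_functions X Y U V.
               openin (zar X) U \<and> openin (zar Y) V \<and> openin (prod_zariski X Y) W \<and>
               w \<in> W \<and> W \<subseteq> D \<inter> (U \<times> V) \<and> (\<forall>v\<in>W. b v \<noteq> 0 \<and> f v = a v / b v)})\<rparr>"

section \<open>Algebraic varieties\<close>

definition locally_affine :: "'a fspace \<Rightarrow> bool" where
  "locally_affine X \<longleftrightarrow>
     (\<forall>x\<in>points X. \<exists>U n Z \<phi>. openin (zar X) U \<and> x \<in> U \<and> closedin (zariski n) Z \<and>
        isomorphism (restrict_fspace X U) (affine_variety n Z) \<phi>)"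

definition separated :: "'a fspace \<Rightarrow> bool" where
  "separated X \<longleftrightarrow> closedin (prod_zariski X X) {(x, x) |x. x \<in> points X}"

text \<open>Varieties need be neither irreducible nor connected.\<close>

definition algebraic_variety :: "'a fspace \<Rightarrow> bool" where
  "algebraic_variety X \<longleftrightarrow> space_with_functions X \<and> locally_affine X \<and> separated X"

section \<open>Dimension\<close>

definition irreducible_in :: "'a topology \<Rightarrow> 'a set \<Rightarrow> bool" where
  "irreducible_in T Z \<longleftrightarrow> Z \<noteq> {} \<and> Z \<subseteq> topspace T \<and>
     (\<forall>A B. closedin T A \<longrightarrow> closedin T B \<longrightarrow> Z \<subseteq> A \<union> B \<longrightarrow> Z \<subseteq> A \<or> Z \<subseteq> B)"

definition krull_dim :: "'a topology \<Rightarrow> enat" where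
  "krull_dim T = Sup {enat k |k. \<exists>Z :: nat \<Rightarrow> 'a set.
     (\<forall>i\<le>k. closedin T (Z i) \<and> irreducible_in T (Z i)) \<and> (\<forall>i<k. Z i \<subset> Z (Suc i))}"

text \<open>
  The dimension at a point; on an irreducible or connected manifold it is the same at all points
  and equals the Krull dimension of the whole space.
\<close>

definition dim_at :: "'a fspace \<Rightarrow> 'a \<Rightarrow> enat" where
  "dim_at X x = Inf {krull_dim (subtopology (zar X) U) |U. openin (zar X) U \<and> x \<in> U}"

section \<open>Tangent spaces and differentials\<close>

definition regular_at :: "'a fspace \<Rightarrow> 'a \<Rightarrow> ('a \<Rightarrow> complex) set" where
  "regular_at X x = {f. \<exists>U. openin (zar X) U \<and> x \<in> U \<and> f \<in> reg X U}"

text \<open>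
  Point derivations of the local ring at \<open>x\<close>. A germ is given by any of its representatives,
  and a derivation is made a total function by the value \<open>0\<close> on functions that are not regular
  at \<open>x\<close>, so that equality of derivations is equality of functions.
\<close>

definition tangent_space :: "'a fspace \<Rightarrow> 'a \<Rightarrow> (('a \<Rightarrow> complex) \<Rightarrow> complex) set" where
  "tangent_space X x = {D.
     (\<forall>f. f \<notin> regular_at X x \<longrightarrow> D f = 0) \<and>
     (\<forall>U f g. openin (zar X) U \<longrightarrow> x \<in> U \<longrightarrow> f \<in> reg X U \<longrightarrow> (\<forall>z\<in>U. f z = g z) \<longrightarrow> D f = D g) \<and>
     (\<forall>c. \<forall>f\<in>regular_at X x. D (cscale c f) = c * D f) \<and>
     (\<forall>f\<in>regular_at X x. \<forall>g\<in>regular_at X x. D (f + g) = D f + D g) \<and>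
     (\<forall>f\<in>regular_at X x. \<forall>g\<in>regular_at X x. D (f * g) = f x * D g + g x * D f)}"

text \<open>
  The differential at \<open>x\<close> of a morphism \<open>f\<close> into \<open>Y\<close>, as a map into the tangent space of
  \<open>Y\<close> at \<open>f x\<close>, applied to tangent vectors of the source at \<open>x\<close>.
\<close>

definition differential ::
  "'b fspace \<Rightarrow> ('a \<Rightarrow> 'b) \<Rightarrow> 'a \<Rightarrow> (('a \<Rightarrow> complex) \<Rightarrow> complex) \<Rightarrow> ('b \<Rightarrow> complex) \<Rightarrow> complex" where
  "differential Y f x D = (\<lambda>g. if g \<in> regular_at Y (f x) then D (g \<circ> f) else 0)"

text \<open>
  Tangent vectors of \<open>X\<close> at \<open>x\<close> that are tangent to the subvariety \<open>Z\<close>: those that kill all germs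
  vanishing on \<open>Z\<close>.
\<close>

definition tangent_to :: "'a fspace \<Rightarrow> 'a set \<Rightarrow> 'a \<Rightarrow> (('a \<Rightarrow> complex) \<Rightarrow> complex) set" where
  "tangent_to X Z x = {D \<in> tangent_space X x.
     \<forall>U g. openin (zar X) U \<longrightarrow> x \<in> U \<longrightarrow> g \<in> reg X U \<longrightarrow> (\<forall>z\<in>U \<inter> Z. g z = 0) \<longrightarrow> D g = 0}"

definition smooth_variety :: "'a fspace \<Rightarrow> bool" where
  "smooth_variety X \<longleftrightarrow> algebraic_variety X \<and>
     (\<forall>x\<in>points X. enat (cfun.dim (tangent_space X x)) = dim_at X x)"

definition algebraic_manifold :: "'a fspace \<Rightarrow> bool" where
  "algebraic_manifold X \<longleftrightarrow> smooth_variety X \<and> compact_space (zar X)"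

section \<open>Algebraic vector bundles and sprays\<close>

record ('e, 'a) vbundle =
  total :: "'e fspace"
  proj :: "'e \<Rightarrow> 'a"
  bzero :: "'a \<Rightarrow> 'e"
  badd :: "'e \<Rightarrow> 'e \<Rightarrow> 'e"
  bscale :: "complex \<Rightarrow> 'e \<Rightarrow> 'e"

definition fibre :: "('e, 'a) vbundle \<Rightarrow> 'a \<Rightarrow> 'e set" where
  "fibre E y = {e \<in> points (total E). proj E e = y}"

definition local_trivialization ::
  "'a fspace \<Rightarrow> ('e, 'a) vbundle \<Rightarrow> 'a set \<Rightarrow> nat \<Rightarrow> ('e \<Rightarrow> 'a \<times> (nat \<Rightarrow> complex)) \<Rightarrow> bool" where
  "local_trivialization Y E U r \<phi> \<longleftrightarrow>
     isomorphism
       (restrict_fspace (total E) {e \<in> points (total E). proj E e \<in> U})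
       (prod_fspace (restrict_fspace Y U) (affine_space r)) \<phi> \<and>
     (\<forall>y\<in>U. \<forall>e\<in>fibre E y. fst (\<phi> e) = y) \<and>
     (\<forall>y\<in>U. snd (\<phi> (bzero E y)) = 0) \<and>
     (\<forall>y\<in>U. \<forall>e\<in>fibre E y. \<forall>e'\<in>fibre E y. snd (\<phi> (badd E e e')) = snd (\<phi> e) + snd (\<phi> e')) \<and>
     (\<forall>y\<in>U. \<forall>c. \<forall>e\<in>fibre E y. snd (\<phi> (bscale E c e)) = cscale c (snd (\<phi> e)))"

text \<open>
  The vector space axioms in the fibres follow, since the local trivializations identify each
  fibre and its operations with some \<open>\<complex>\<^sup>r\<close>. The rank \<open>r\<close> may vary with the point.
\<close>

definition algebraic_vector_bundle :: "'a fspace \<Rightarrow> ('e, 'a) vbundle \<Rightarrow> bool" where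
  "algebraic_vector_bundle Y E \<longleftrightarrow>
     algebraic_variety (total E) \<and> morphism (total E) Y (proj E) \<and>
     (\<forall>y\<in>points Y. bzero E y \<in> fibre E y \<and>
        (\<forall>e\<in>fibre E y. \<forall>e'\<in>fibre E y. badd E e e' \<in> fibre E y) \<and>
        (\<forall>c. \<forall>e\<in>fibre E y. bscale E c e \<in> fibre E y)) \<and>
     (\<forall>y\<in>points Y. \<exists>U r \<phi>. openin (zar Y) U \<and> y \<in> U \<and> local_trivialization Y E U r \<phi>)"

definition algebraic_spray :: "'a fspace \<Rightarrow> ('e, 'a) vbundle \<Rightarrow> ('e \<Rightarrow> 'a) \<Rightarrow> bool" where
  "algebraic_spray Y E s \<longleftrightarrow>
     algebraic_vector_bundle Y E \<and> morphism (total E) Y s \<and> (\<forall>y\<in>points Y. s (bzero E y) = y)"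

definition dominating_family ::
  "'a fspace \<Rightarrow> nat \<Rightarrow> (nat \<Rightarrow> ('e, 'a) vbundle) \<Rightarrow> (nat \<Rightarrow> 'e \<Rightarrow> 'a) \<Rightarrow> bool" where
  "dominating_family Y m E s \<longleftrightarrow>
     (\<forall>y\<in>points Y.
        {\<Sum>j<m. v j |v. \<forall>j<m. v j \<in> differential Y (s j) (bzero (E j) y) `
            tangent_to (total (E j)) (fibre (E j) y) (bzero (E j) y)}
        = tangent_space Y y)"

text \<open>
  HOL cannot quantify over the type of points of the total spaces, so that type is a parameter.
  A common type for all members of the family is no restriction, as the total spaces can be
  transported to a disjoint sum of their types.
\<close>

definition algebraically_subelliptic :: "'e itself \<Rightarrow> 'a fspace \<Rightarrow> bool" where
  "algebraically_subelliptic _ Y \<longleftrightarrow> algebraic_manifold Y \<and>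
     (\<exists>m (E :: nat \<Rightarrow> ('e, 'a) vbundle) s.
        (\<forall>j<m. algebraic_spray Y (E j) (s j)) \<and> dominating_family Y m E s)"

section \<open>Dominability\<close>

definition algebraically_dominable_at :: "'a fspace \<Rightarrow> 'a \<Rightarrow> bool" where
  "algebraically_dominable_at X x \<longleftrightarrow>
     (\<exists>n f. enat n = dim_at X x \<and> morphism (affine_space n) X f \<and> f 0 = x \<and>
        bij_betw (differential X f 0) (tangent_space (affine_space n) 0) (tangent_space X x))"

definition strongly_algebraically_dominable :: "'a fspace \<Rightarrow> bool" where
  "strongly_algebraically_dominable X \<longleftrightarrow> (\<forall>x\<in>points X. algebraically_dominable_at X x)"

end

theory Submission
  imports Defs "HOL-Computational_Algebra.Fundamental_Theorem_Algebra"
begin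

text \<open>
  Let \<open>x\<close> be a point of the manifold \<open>X\<close> of dimension \<open>n\<close> at \<open>x\<close>. Because the family of sprays is
  dominating, \<open>T\<^sub>xX\<close> has a basis each of whose members is the velocity at \<open>t = 0\<close> of a curve
  \<open>t \<mapsto> s (t e)\<close>, where \<open>s\<close> is one of the sprays and \<open>e\<close> a vector over \<open>x\<close> in its bundle
  (\<open>spray_differential_spanned_by_velocities\<close>). A regular map \<open>f\<close> from affine \<open>n\<close>-space to \<open>X\<close> that
  sends \<open>0\<close> to \<open>x\<close> and follows these curves on the coordinate axes has an isomorphism as its
  differential at \<open>0\<close> (\<open>bij_betw_differential_of_basis\<close>).

  Such a map is obtained from the constant map \<open>x\<close> by correcting one axis at a time. Given \<open>f\<close> and a
  vector \<open>e\<close> over \<open>f 0 = x\<close>, let \<open>\<sigma>\<close> be a section along \<open>f\<close> with \<open>\<sigma> 0 = e\<close>, and replace \<open>f\<close> by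
  \<open>z \<mapsto> s (z k * \<sigma> (z(k := 0)))\<close>. As a spray restricts to the identity on the zero section,
  the values on the hyperplane \<open>z k = 0\<close> are unchanged, and the axis \<open>k\<close> is now mapped along
  \<open>t \<mapsto> s (t e)\<close> (\<open>prescribe_map_on_axis\<close>).

  The substance is the existence of \<open>\<sigma>\<close> (\<open>exists_section_through\<close>): the pullback of an algebraic
  vector bundle to affine space is generated by global sections. A section defined near the origin,
  on a principal open set \<open>h \<noteq> 0\<close>, becomes global after multiplication by a power of \<open>h\<close>. For this
  one needs that affine space is quasi-compact and that regular functions on a set \<open>H \<noteq> 0\<close> are
  of the form \<open>p / H ^ N\<close> with a polynomial \<open>p\<close>. Both are consequences of Hilbert's
  Nullstellensatz, which is proved here for \<open>\<complex>\<close> by the argument that a countably generated algebra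
  has no room for the uncountably many independent elements \<open>1 / (u - c)\<close>.
\<close>

section \<open>Polynomial functions and the Nullstellensatz\<close>

lemma poly_fun_cmult: "p \<in> poly_fun n \<Longrightarrow> (\<lambda>z. c * p z) \<in> poly_fun n"
  by (rule poly_fun.mult[OF poly_fun.const])

lemma poly_fun_diff:
  assumes "p \<in> poly_fun n" "q \<in> poly_fun n"
  shows "(\<lambda>z. p z - q z) \<in> poly_fun n"
  using poly_fun.add[OF assms(1) poly_fun_cmult[OF assms(2), of "-1"]] by simp

lemma poly_fun_power: "p \<in> poly_fun n \<Longrightarrow> (\<lambda>z. p z ^ k) \<in> poly_fun n"
  by (induction k) (auto intro: poly_fun.const poly_fun.mult)

lemma poly_fun_prod: "(\<And>i. i \<in> T \<Longrightarrow> p i \<in> poly_fun n) \<Longrightarrow> (\<lambda>z. \<Prod>i\<in>T. p i z) \<in> poly_fun n"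
  by (induction T rule: infinite_finite_induct) (auto intro: poly_fun.const poly_fun.mult)

lemma poly_fun_poly: "u \<in> poly_fun n \<Longrightarrow> (\<lambda>z. poly Q (u z)) \<in> poly_fun n"
  by (induction Q) (auto intro: poly_fun.const poly_fun.mult poly_fun.add)

lemma poly_fun_on_line:
  "p \<in> poly_fun n \<Longrightarrow> \<exists>P :: complex poly. \<forall>t. p (\<lambda>i. a i + t * b i) = poly P t"
proof (induction rule: poly_fun.induct)
  case (const c) show ?case by (rule exI[of _ "[:c:]"]) simp
next
  case (coord i) show ?case by (rule exI[of _ "[:a i, b i:]"]) simp
next
  case (add p q) then show ?case by (metis poly_add)
next
  case (mult p q) then show ?case by (metis poly_mult)
qed

text \<open>
  On the line through \<open>w\<close> and \<open>z\<close> both factors become polynomials in one variable, where there are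
  no zero divisors. This is the irreducibility of affine space.
\<close>

lemma poly_fun_no_zero_divisors:
  assumes p: "p \<in> poly_fun n" and q: "q \<in> poly_fun n"
    and pq: "\<And>z. z \<in> affine_points n \<Longrightarrow> p z * q z = 0"
    and w: "w \<in> affine_points n" "q w \<noteq> 0" and z: "z \<in> affine_points n"
  shows "p z = 0"
proof -
  obtain P where P: "\<And>t. p (\<lambda>i. w i + t * (z i - w i)) = poly P t"
    using poly_fun_on_line[OF p, of w "\<lambda>i. z i - w i"] by blast
  obtain Q where Q: "\<And>t. q (\<lambda>i. w i + t * (z i - w i)) = poly Q t"
    using poly_fun_on_line[OF q, of w "\<lambda>i. z i - w i"] by blast
  have "poly (P * Q) t = 0" for t
    using pq[of "\<lambda>i. w i + t * (z i - w i)"] w(1) z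
    by (simp add: P[symmetric] Q[symmetric] affine_points_def)
  then have "P * Q = 0" using poly_all_0_iff_0 by blast
  moreover have "Q \<noteq> 0" using Q[of 0] w(2) by auto
  ultimately have "P = 0" by simp
  then show ?thesis using P[of 1] by simp
qed

definition monomial_fun :: "nat list \<Rightarrow> (nat \<Rightarrow> complex) \<Rightarrow> complex" where
  "monomial_fun L z = (\<Prod>i\<leftarrow>L. z i)"

lemma span_monomial_fun_mult:
  assumes p: "p \<in> cfun.span (range monomial_fun)" and q: "q \<in> cfun.span (range monomial_fun)"
  shows "(\<lambda>z. p z * q z) \<in> cfun.span (range monomial_fun)"
  using p
proof (induction rule: cfun.span_induct_alt)
  case base
  show ?case using cfun.span_zero by (simp add: zero_fun_def)
next
  case (step c m y)
  then obtain L where m: "m = monomial_fun L" by auto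
  have "(\<lambda>z. m z * q z) \<in> cfun.span (range monomial_fun)"
    using q
  proof (induction rule: cfun.span_induct_alt)
    case base
    show ?case using cfun.span_zero by (simp add: zero_fun_def)
  next
    case (step c' m' y')
    then obtain L' where m': "m' = monomial_fun L'" by auto
    have "(\<lambda>z. m z * (cscale c' m' + y') z) = cscale c' (monomial_fun (L @ L')) + (\<lambda>z. m z * y' z)"
      by (auto simp: fun_eq_iff m m' cscale_def monomial_fun_def algebra_simps)
    then show ?case
      using cfun.span_add[OF cfun.span_scale[OF cfun.span_base[OF rangeI]] step.IH] by simp
  qed
  moreover have "(\<lambda>z. (cscale c m + y) z * q z) = cscale c (\<lambda>z. m z * q z) + (\<lambda>z. y z * q z)"
    by (auto simp: fun_eq_iff cscale_def algebra_simps)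
  ultimately show ?case using cfun.span_add[OF cfun.span_scale step.IH] by simp
qed

lemma poly_fun_subset_span: "poly_fun n \<subseteq> cfun.span (range monomial_fun)"
proof
  fix p assume "p \<in> poly_fun n"
  then show "p \<in> cfun.span (range monomial_fun)"
  proof (induction rule: poly_fun.induct)
    case (const c)
    have "(\<lambda>_. c) = cscale c (monomial_fun [])" by (auto simp: cscale_def monomial_fun_def)
    then show ?case using cfun.span_scale cfun.span_base by (metis rangeI)
  next
    case (coord i)
    have "(\<lambda>z. z i) = monomial_fun [i]" by (auto simp: monomial_fun_def)
    then show ?case using cfun.span_base by (metis rangeI)
  next
    case (add p q)
    then show ?case using cfun.span_add[OF add.IH] by (simp add: plus_fun_def)
  next
    case (mult p q)
    then show ?case by (intro span_monomial_fun_mult)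
  qed
qed

text \<open>
  The algebra of polynomial functions has a countable spanning set, whereas \<open>\<complex>\<close> is uncountable. The
  Nullstellensatz below rests on this contrast.
\<close>

lemma poly_fun_countable_exhaustion:
  obtains F :: "nat \<Rightarrow> ((nat \<Rightarrow> complex) \<Rightarrow> complex) set"
  where "\<And>d. finite (F d)" "\<And>p. p \<in> poly_fun n \<Longrightarrow> \<exists>d. p \<in> cfun.span (F d)"
proof
  let ?F = "\<lambda>d. (\<lambda>k. monomial_fun (from_nat k)) ` {..<d::nat}"
  show "finite (?F d)" for d by simp
  fix p assume "p \<in> poly_fun n"
  then have "p \<in> cfun.span (range monomial_fun)" using poly_fun_subset_span by blast
  then show "\<exists>d. p \<in> cfun.span (?F d)"
  proof (induction rule: cfun.span_induct_alt)
    case base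
    show ?case using cfun.span_zero by (auto simp: zero_fun_def)
  next
    case (step c m y)
    then obtain L d where m: "m = monomial_fun L" and d: "y \<in> cfun.span (?F d)" by auto
    let ?d = "max d (Suc (to_nat L))"
    have "m \<in> ?F ?d"
      unfolding m by (rule image_eqI[of _ _ "to_nat L"]) auto
    moreover have "?F d \<subseteq> ?F ?d" by (intro image_mono) auto
    ultimately have "cscale c m + y \<in> cfun.span (?F ?d)"
      using d cfun.span_mono[of "?F d" "?F ?d"]
      by (intro cfun.span_add cfun.span_scale) (auto intro: cfun.span_base)
    then show ?case by blast
  qed
qed

lemma infinite_family_linear_relation:
  fixes g :: "'c \<Rightarrow> 'b \<Rightarrow> complex"
  assumes "finite F" and "infinite S" and g: "\<And>c. c \<in> S \<Longrightarrow> g c \<in> cfun.span F"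
  obtains T l where "finite T" "T \<subseteq> S" "\<exists>c\<in>T. l c \<noteq> 0" "\<And>z. (\<Sum>c\<in>T. l c * g c z) = 0"
proof (cases "inj_on g S")
  case False
  then obtain a b where ab: "a \<in> S" "b \<in> S" "a \<noteq> b" "g a = g b" by (auto simp: inj_on_def)
  show ?thesis
    by (rule that[of "{a, b}" "\<lambda>c. if c = a then 1 else -1"]) (use ab in auto)
next
  case True
  then have "infinite (g ` S)" using assms(2) finite_imageD by blast
  moreover have "g ` S \<subseteq> cfun.span F" using g by blast
  ultimately have "cfun.dependent (g ` S)"
    using cfun.independent_span_bound[OF assms(1)] by blast
  then obtain t u v where t: "finite t" "t \<subseteq> g ` S" "(\<Sum>v\<in>t. cscale (u v) v) = 0" "v \<in> t" "u v \<noteq> 0"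
    unfolding cfun.dependent_explicit by blast
  obtain T where T: "T \<subseteq> S" "t = g ` T" using t(2) by (auto simp: subset_image_iff)
  have inj: "inj_on g T" using True T(1) inj_on_subset by blast
  show ?thesis
  proof (rule that[of T "u \<circ> g"])
    show "finite T" using t(1) T inj finite_imageD by blast
    show "T \<subseteq> S" by fact
    show "\<exists>c\<in>T. (u \<circ> g) c \<noteq> 0" using t T by auto
    fix z
    have "(\<Sum>v\<in>t. cscale (u v) v) z = (\<Sum>v\<in>t. u v * v z)"
      using t(1) by (induction rule: finite_induct) (auto simp: cscale_def)
    then have "(\<Sum>v\<in>t. u v * v z) = 0" using t(3) by simp
    then show "(\<Sum>c\<in>T. (u \<circ> g) c * g c z) = 0"
      unfolding T(2) by (simp add: sum.reindex[OF inj])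
  qed
qed

definition poly_ideal :: "nat \<Rightarrow> ((nat \<Rightarrow> complex) \<Rightarrow> complex) set \<Rightarrow> bool" where
  "poly_ideal n I \<longleftrightarrow> I \<subseteq> poly_fun n \<and> (\<lambda>_. 0) \<in> I \<and>
     (\<forall>p\<in>I. \<forall>q\<in>I. (\<lambda>z. p z + q z) \<in> I) \<and>
     (\<forall>a\<in>poly_fun n. \<forall>p\<in>I. (\<lambda>z. a z * p z) \<in> I)"

lemma poly_idealD:
  assumes "poly_ideal n I"
  shows poly_ideal_sub: "p \<in> I \<Longrightarrow> p \<in> poly_fun n"
    and poly_ideal_zero: "(\<lambda>_. 0) \<in> I"
    and poly_ideal_add: "p \<in> I \<Longrightarrow> q \<in> I \<Longrightarrow> (\<lambda>z. p z + q z) \<in> I"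
    and poly_ideal_mult: "a \<in> poly_fun n \<Longrightarrow> p \<in> I \<Longrightarrow> (\<lambda>z. a z * p z) \<in> I"
  using assms unfolding poly_ideal_def by auto

lemma poly_ideal_diff:
  assumes "poly_ideal n I" "p \<in> I" "q \<in> I"
  shows "(\<lambda>z. p z - q z) \<in> I"
  using poly_ideal_add[OF assms(1,2) poly_ideal_mult[OF assms(1) poly_fun.const assms(3)], of "-1"]
  by simp

lemma poly_ideal_sum:
  assumes "poly_ideal n I" "\<And>i. i \<in> T \<Longrightarrow> p i \<in> I"
  shows "(\<lambda>z. \<Sum>i\<in>T. p i z) \<in> I"
  using assms(2)
  by (induction T rule: infinite_finite_induct)
     (auto intro: poly_ideal_add[OF assms(1)] poly_ideal_zero[OF assms(1)])

text \<open>
  If \<open>u - c\<close> divides a power of \<open>H\<close> modulo \<open>I\<close> for every \<open>c\<close>, then the linear factors of \<open>Q\<close> can be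
  cancelled from \<open>H ^ N * Q(u)\<close> one by one, each at the price of a higher power of \<open>H\<close>.
\<close>

lemma power_in_ideal_of_poly_in_ideal:
  assumes I: "poly_ideal n I" and H: "H \<in> poly_fun n" and u: "u \<in> poly_fun n"
    and all: "\<And>c. \<exists>N. \<exists>g\<in>poly_fun n. \<exists>m\<in>I. \<forall>z. H z ^ N = (u z - c) * g z + m z"
    and "Q \<noteq> 0" "(\<lambda>z. H z ^ N * poly Q (u z)) \<in> I"
  shows "\<exists>N. (\<lambda>z. H z ^ N) \<in> I"
  using assms(5,6)
proof (induction "degree Q" arbitrary: Q N)
  case 0
  then obtain c where c: "Q = [:c:]" "c \<noteq> 0" by (metis degree_eq_zeroE pCons_0_0)
  have "(\<lambda>z. (1 / c) * (H z ^ N * poly Q (u z))) \<in> I"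
    by (rule poly_ideal_mult[OF I poly_fun.const 0(3)])
  then show ?case using c by auto
next
  case (Suc d)
  have "\<not> constant (poly Q)" using Suc.hyps(2) by (simp add: constant_degree)
  then obtain a where a: "poly Q a = 0" using fundamental_theorem_of_algebra by blast
  then obtain R where R: "Q = [:- a, 1:] * R" using poly_eq_0_iff_dvd by (metis dvdE)
  have R0: "R \<noteq> 0" using R Suc.prems(1) by auto
  have "degree Q = Suc (degree R)" using degree_mult_eq[of "[:- a, 1:]" R] R R0 by simp
  then have dR: "d = degree R" using Suc.hyps(2) by simp
  obtain K g m where g: "g \<in> poly_fun n" "m \<in> I" "\<And>z. H z ^ K = (u z - a) * g z + m z"
    using all by blast
  have "(\<lambda>z. g z * (H z ^ N * poly Q (u z)) + (H z ^ N * poly R (u z)) * m z) \<in> I"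
    by (intro poly_ideal_add[OF I] poly_ideal_mult[OF I] Suc.prems g poly_fun.mult
        poly_fun_power poly_fun_poly H u)
  moreover have "(\<lambda>z. g z * (H z ^ N * poly Q (u z)) + (H z ^ N * poly R (u z)) * m z)
     = (\<lambda>z. H z ^ (K + N) * poly R (u z))"
    by (simp add: power_add g(3) R fun_eq_iff algebra_simps)
  ultimately have "(\<lambda>z. H z ^ (K + N) * poly R (u z)) \<in> I" by simp
  from Suc.hyps(1)[OF dR R0 this] show ?case .
qed

text \<open>
  Geometrically, if \<open>H\<close> is not nilpotent modulo \<open>I\<close>, then \<open>u\<close> takes some value \<open>c\<close> on the part of the
  zero set of \<open>I\<close> where \<open>H\<close> does not vanish. Otherwise every \<open>u - c\<close> divides some \<open>H ^ N\<close> modulo \<open>I\<close>,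
  with cofactor \<open>g c\<close>, say. These cofactors behave like \<open>H ^ N / (u - c)\<close>; uncountably many
  of them lie in a countable union of finite-dimensional spaces, so infinitely many with the same \<open>N\<close>
  lie in one of these spaces and some finitely many satisfy a linear relation. Clearing denominators
  turns it into a non-zero polynomial \<open>Q\<close> with \<open>H ^ N * Q(u) \<in> I\<close>.
\<close>

lemma exists_value_avoiding_powers:
  assumes I: "poly_ideal n I" and H: "H \<in> poly_fun n" and u: "u \<in> poly_fun n"
    and no: "\<And>N. (\<lambda>z. H z ^ N) \<notin> I"
  shows "\<exists>c. \<forall>N. \<forall>g\<in>poly_fun n. \<forall>m\<in>I. (\<lambda>z. H z ^ N) \<noteq> (\<lambda>z. (u z - c) * g z + m z)"
proof (rule ccontr)
  assume "\<not> ?thesis"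
  then have all: "\<exists>N. \<exists>g\<in>poly_fun n. \<exists>m\<in>I. \<forall>z. H z ^ N = (u z - c) * g z + m z" for c
    unfolding fun_eq_iff by blast
  then obtain N g m where g: "\<And>c. g c \<in> poly_fun n" "\<And>c. m c \<in> I"
    and eq: "\<And>c z. H z ^ N c = (u z - c) * g c z + m c z" by metis
  obtain F :: "nat \<Rightarrow> ((nat \<Rightarrow> complex) \<Rightarrow> complex) set"
    where F: "\<And>d. finite (F d)" "\<And>p. p \<in> poly_fun n \<Longrightarrow> \<exists>d. p \<in> cfun.span (F d)"
    using poly_fun_countable_exhaustion[where n = n] by metis
  obtain d where d: "\<And>c. g c \<in> cfun.span (F (d c))" using F(2)[OF g(1)] by metis
  have "\<exists>k e. infinite {c. N c = k \<and> d c = e}"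
  proof (rule ccontr)
    assume "\<not> ?thesis"
    then have "countable (\<Union>(k, e)\<in>UNIV. {c. N c = k \<and> d c = e})"
      by (intro countable_UN) (auto intro: countable_finite)
    moreover have "(\<Union>(k, e)\<in>UNIV. {c. N c = k \<and> d c = e}) = UNIV" by auto
    ultimately show False using uncountable_UNIV_complex by metis
  qed
  then obtain k e where inf: "infinite {c. N c = k \<and> d c = e}" by blast
  have gS: "g c \<in> cfun.span (F e)" if "c \<in> {c. N c = k \<and> d c = e}" for c using d[of c] that by auto
  obtain T l where T: "finite T" "T \<subseteq> {c. N c = k \<and> d c = e}" "\<exists>c\<in>T. l c \<noteq> 0"
    and rel: "\<And>z. (\<Sum>c\<in>T. l c * g c z) = 0"
    by (rule infinite_family_linear_relation[OF F(1) inf gS]) auto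
  define Q where "Q = (\<Sum>c\<in>T. smult (l c) (\<Prod>b\<in>T - {c}. [:- b, 1:]))"
  have pQ: "poly Q x = (\<Sum>c\<in>T. l c * (\<Prod>b\<in>T - {c}. x - b))" for x
    by (simp add: Q_def poly_sum poly_prod)
  obtain c where c: "c \<in> T" "l c \<noteq> 0" using T(3) by blast
  have "poly Q c = (\<Sum>a\<in>T. if a = c then l c * (\<Prod>b\<in>T - {c}. c - b) else 0)"
    unfolding pQ
  proof (rule sum.cong)
    fix a assume a: "a \<in> T"
    have "(\<Prod>b\<in>T - {a}. c - b) = 0" if "a \<noteq> c"
      using T(1) c(1) that by (auto simp: prod_zero_iff)
    then show "l a * (\<Prod>b\<in>T - {a}. c - b) = (if a = c then l c * (\<Prod>b\<in>T - {c}. c - b) else 0)"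
      by auto
  qed simp
  also have "\<dots> = l c * (\<Prod>b\<in>T - {c}. c - b)" using T(1) c(1) by simp
  finally have "poly Q c \<noteq> 0" using c T(1) by auto
  then have Q0: "Q \<noteq> 0" by auto
  have "(\<lambda>z. H z ^ k * poly Q (u z)) = (\<lambda>z. \<Sum>c\<in>T. (l c * (\<Prod>b\<in>T - {c}. u z - b)) * m c z)"
  proof
    fix z
    have "H z ^ k * poly Q (u z) =
        (\<Sum>c\<in>T. (l c * (\<Prod>b\<in>T - {c}. u z - b)) * ((u z - c) * g c z + m c z))"
      unfolding pQ sum_distrib_left
    proof (rule sum.cong)
      fix c assume "c \<in> T"
      then have "N c = k" using T by auto
      then have "H z ^ k = (u z - c) * g c z + m c z" using eq by metis
      then show "H z ^ k * (l c * (\<Prod>b\<in>T - {c}. u z - b)) =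
          l c * (\<Prod>b\<in>T - {c}. u z - b) * ((u z - c) * g c z + m c z)" by simp
    qed simp
    also have "\<dots> = (\<Sum>c\<in>T. l c * g c z * (\<Prod>b\<in>T. u z - b))
        + (\<Sum>c\<in>T. (l c * (\<Prod>b\<in>T - {c}. u z - b)) * m c z)"
      unfolding sum.distrib[symmetric]
    proof (rule sum.cong)
      fix c assume "c \<in> T"
      then have split: "(\<Prod>b\<in>T. u z - b) = (u z - c) * (\<Prod>b\<in>T - {c}. u z - b)"
        using T(1) by (simp add: prod.remove)
      show "l c * (\<Prod>b\<in>T - {c}. u z - b) * ((u z - c) * g c z + m c z) =
          l c * g c z * (\<Prod>b\<in>T. u z - b) + l c * (\<Prod>b\<in>T - {c}. u z - b) * m c z"
        unfolding split by (simp add: algebra_simps)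
    qed simp
    also have "(\<Sum>c\<in>T. l c * g c z * (\<Prod>b\<in>T. u z - b)) = 0"
      using rel[of z] by (simp add: sum_distrib_right[symmetric])
    finally show "H z ^ k * poly Q (u z) = (\<Sum>c\<in>T. (l c * (\<Prod>b\<in>T - {c}. u z - b)) * m c z)" by simp
  qed
  moreover have "(\<lambda>z. \<Sum>c\<in>T. (l c * (\<Prod>b\<in>T - {c}. u z - b)) * m c z) \<in> I"
    by (intro poly_ideal_sum[OF I] poly_ideal_mult[OF I] g poly_fun.mult poly_fun.const
        poly_fun_prod poly_fun_diff u)
  ultimately have "(\<lambda>z. H z ^ k * poly Q (u z)) \<in> I" by simp
  from power_in_ideal_of_poly_in_ideal[OF I H u all Q0 this] show False using no by blast
qed

lemma poly_ideal_adjoin: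
  assumes I: "poly_ideal n I" and u: "u \<in> poly_fun n"
  shows "poly_ideal n {(\<lambda>z. u z * g z + m z) |g m. g \<in> poly_fun n \<and> m \<in> I}"
    (is "poly_ideal n ?J")
  unfolding poly_ideal_def
proof (intro conjI ballI)
  show "?J \<subseteq> poly_fun n" using u poly_ideal_sub[OF I] by (auto intro!: poly_fun.add poly_fun.mult)
  show "(\<lambda>_. 0) \<in> ?J"
    by (intro CollectI exI[of _ "\<lambda>_. 0"]) (simp add: poly_fun.const poly_ideal_zero[OF I])
next
  fix p q assume "p \<in> ?J" "q \<in> ?J"
  then obtain g m g' m' where p: "p = (\<lambda>z. u z * g z + m z)" "g \<in> poly_fun n" "m \<in> I"
    and q: "q = (\<lambda>z. u z * g' z + m' z)" "g' \<in> poly_fun n" "m' \<in> I" by blast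
  have "(\<lambda>z. p z + q z) = (\<lambda>z. u z * (g z + g' z) + (m z + m' z))"
    by (simp add: p q algebra_simps)
  then show "(\<lambda>z. p z + q z) \<in> ?J"
    by (intro CollectI exI conjI, assumption)
      (intro poly_fun.add poly_ideal_add[OF I] p q)+
next
  fix a p assume a: "a \<in> poly_fun n" and "p \<in> ?J"
  then obtain g m where p: "p = (\<lambda>z. u z * g z + m z)" "g \<in> poly_fun n" "m \<in> I" by blast
  have "(\<lambda>z. a z * p z) = (\<lambda>z. u z * (a z * g z) + (a z * m z))"
    by (simp add: p algebra_simps)
  then show "(\<lambda>z. a z * p z) \<in> ?J"
    by (intro CollectI exI conjI, assumption)
      (intro poly_fun.mult poly_ideal_mult[OF I] a p)+
qed

lemma poly_fun_minus_value_in_ideal: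
  assumes J: "poly_ideal n J" and a: "\<And>i. i < n \<Longrightarrow> (\<lambda>z. z i - a i) \<in> J" and "p \<in> poly_fun n"
  shows "(\<lambda>z. p z - p a) \<in> J"
  using assms(3)
proof (induction rule: poly_fun.induct)
  case (const c) then show ?case using poly_ideal_zero[OF J] by simp
next
  case (coord i) then show ?case using a by simp
next
  case (add p q)
  show ?case using poly_ideal_add[OF J add.IH] by (simp add: algebra_simps)
next
  case (mult p q)
  have "(\<lambda>z. q z * (p z - p a) + p a * (q z - q a)) \<in> J"
    by (intro poly_ideal_add[OF J] poly_ideal_mult[OF J] mult poly_fun.const)
  then show ?case by (simp add: algebra_simps)
qed

text \<open>
  Coordinate by coordinate, a value \<open>a i\<close> is chosen so that adjoining \<open>z i - a i\<close> to the ideal still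
  keeps all powers of \<open>H\<close> out. Modulo the final ideal each polynomial equals its value at \<open>a\<close>, so \<open>a\<close>
  is a zero of \<open>I\<close> with \<open>H a \<noteq> 0\<close>.
\<close>

theorem nullstellensatz:
  assumes I: "poly_ideal n I" and H: "H \<in> poly_fun n"
    and V: "\<And>z. z \<in> affine_points n \<Longrightarrow> (\<And>p. p \<in> I \<Longrightarrow> p z = 0) \<Longrightarrow> H z = 0"
  shows "\<exists>N. (\<lambda>z. H z ^ N) \<in> I"
proof (rule ccontr)
  assume no: "\<nexists>N. (\<lambda>z. H z ^ N) \<in> I"
  have "k \<le> n \<Longrightarrow> \<exists>J a. poly_ideal n J \<and> I \<subseteq> J \<and> (\<forall>N. (\<lambda>z. H z ^ N) \<notin> J) \<and>
      (\<forall>i<k. (\<lambda>z. z i - a i) \<in> J)" for k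
  proof (induction k)
    case 0
    then show ?case using I no by blast
  next
    case (Suc k)
    then obtain J a where J: "poly_ideal n J" "I \<subseteq> J" "\<And>N. (\<lambda>z. H z ^ N) \<notin> J"
      and a: "\<And>i. i < k \<Longrightarrow> (\<lambda>z. z i - a i) \<in> J" by auto
    have k: "(\<lambda>z. z k) \<in> poly_fun n" using Suc.prems by (intro poly_fun.coord) simp
    obtain c where c: "\<And>N g m. g \<in> poly_fun n \<Longrightarrow> m \<in> J \<Longrightarrow>
        (\<lambda>z. H z ^ N) \<noteq> (\<lambda>z. (z k - c) * g z + m z)"
      using exists_value_avoiding_powers[OF J(1) H k J(3)] by blast
    let ?J = "{(\<lambda>z. (z k - c) * g z + m z) |g m. g \<in> poly_fun n \<and> m \<in> J}"
    have JJ: "J \<subseteq> ?J"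
    proof
      fix p assume p: "p \<in> J"
      show "p \<in> ?J"
        by (intro CollectI exI[of _ "\<lambda>_. 0"] exI[of _ p]) (simp add: p poly_fun.const)
    qed
    have kc: "(\<lambda>z. z k - c) \<in> ?J"
      by (intro CollectI exI[of _ "\<lambda>_. 1"] exI[of _ "\<lambda>_. 0"])
        (simp add: poly_fun.const poly_ideal_zero[OF J(1)])
    have "poly_ideal n ?J"
      by (intro poly_ideal_adjoin J poly_fun_diff k poly_fun.const)
    moreover have "I \<subseteq> ?J" using J JJ by blast
    moreover have "(\<lambda>z. H z ^ N) \<notin> ?J" for N using c by blast
    moreover have "(\<lambda>z. z i - (a(k := c)) i) \<in> ?J" if "i < Suc k" for i
    proof (cases "i = k")
      case True
      then show ?thesis using kc by simp
    next
      case False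
      then show ?thesis using that a[of i] JJ by (simp add: subset_iff del: mem_Collect_eq)
    qed
    ultimately show ?case by (intro exI[of _ ?J] exI[of _ "a(k := c)"]) blast
  qed
  from this[of n] obtain J b where J: "poly_ideal n J" "I \<subseteq> J" "\<And>N. (\<lambda>z. H z ^ N) \<notin> J"
    and b: "\<And>i. i < n \<Longrightarrow> (\<lambda>z. z i - b i) \<in> J" by auto
  define a where "a i = (if i < n then b i else 0)" for i
  have a: "a \<in> affine_points n" by (auto simp: a_def affine_points_def)
  have "(\<lambda>z. z i - a i) \<in> J" if "i < n" for i using b[OF that] that by (simp add: a_def)
  then have ev: "(\<lambda>z. p z - p a) \<in> J" if "p \<in> poly_fun n" for p
    using poly_fun_minus_value_in_ideal[OF J(1)] that by blast
  have "p a = 0" if p: "p \<in> I" for p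
  proof (rule ccontr)
    assume pa: "p a \<noteq> 0"
    have "(\<lambda>z. p z - (p z - p a)) \<in> J"
      using J(2) p I by (intro poly_ideal_diff[OF J(1)] ev poly_ideal_sub) auto
    then have "(\<lambda>z. (1 / p a) * (p z - (p z - p a))) \<in> J"
      by (intro poly_ideal_mult[OF J(1)] poly_fun.const)
    then show False using J(3)[of 0] pa by simp
  qed
  then have "H a = 0" using V a by blast
  then have "H \<in> J" using ev[OF H] by simp
  then show False using J(3)[of 1] by simp
qed

section \<open>Spaces with functions and affine space\<close>

abbreviation basic_open :: "nat \<Rightarrow> ((nat \<Rightarrow> complex) \<Rightarrow> complex) \<Rightarrow> (nat \<Rightarrow> complex) set" where
  "basic_open n p \<equiv> {z \<in> affine_points n. p z \<noteq> 0}"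

lemma bex2I: "a \<in> A \<Longrightarrow> b \<in> B \<Longrightarrow> P a b \<Longrightarrow> \<exists>x\<in>A. \<exists>y\<in>B. P x y"
  by blast

lemma
  assumes X: "space_with_functions X" and U: "openin (zar X) U"
  shows reg_cong: "f \<in> reg X U \<Longrightarrow> (\<And>x. x \<in> U \<Longrightarrow> g x = f x) \<Longrightarrow> g \<in> reg X U"
    and reg_const: "(\<lambda>_. c) \<in> reg X U"
    and reg_add: "f \<in> reg X U \<Longrightarrow> g \<in> reg X U \<Longrightarrow> (\<lambda>x. f x + g x) \<in> reg X U"
    and reg_mult: "f \<in> reg X U \<Longrightarrow> g \<in> reg X U \<Longrightarrow> (\<lambda>x. f x * g x) \<in> reg X U"
    and openin_reg_nonzero: "f \<in> reg X U \<Longrightarrow> openin (zar X) {x \<in> U. f x \<noteq> 0}"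
    and reg_inverse: "f \<in> reg X U \<Longrightarrow> (\<lambda>x. 1 / f x) \<in> reg X {x \<in> U. f x \<noteq> 0}"
    and reg_subset: "f \<in> reg X U \<Longrightarrow> openin (zar X) V \<Longrightarrow> V \<subseteq> U \<Longrightarrow> f \<in> reg X V"
    and reg_local: "(\<And>x. x \<in> U \<Longrightarrow> \<exists>V. openin (zar X) V \<and> x \<in> V \<and> V \<subseteq> U \<and> f \<in> reg X V) \<Longrightarrow> f \<in> reg X U"
proof -
  note * = X[unfolded space_with_functions_def plus_fun_def times_fun_def]
  show "f \<in> reg X U \<Longrightarrow> (\<And>x. x \<in> U \<Longrightarrow> g x = f x) \<Longrightarrow> g \<in> reg X U"
    by (rule *[THEN conjunct1, rule_format, OF U])
  show "(\<lambda>_. c) \<in> reg X U"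
    by (rule *[THEN conjunct2, THEN conjunct1, rule_format, OF U])
  show "f \<in> reg X U \<Longrightarrow> g \<in> reg X U \<Longrightarrow> (\<lambda>x. f x + g x) \<in> reg X U"
    and "f \<in> reg X U \<Longrightarrow> g \<in> reg X U \<Longrightarrow> (\<lambda>x. f x * g x) \<in> reg X U"
    using *[THEN conjunct2, THEN conjunct2, THEN conjunct1, rule_format, OF U] by blast+
  show "f \<in> reg X U \<Longrightarrow> openin (zar X) {x \<in> U. f x \<noteq> 0}"
    and "f \<in> reg X U \<Longrightarrow> (\<lambda>x. 1 / f x) \<in> reg X {x \<in> U. f x \<noteq> 0}"
    using *[THEN conjunct2, THEN conjunct2, THEN conjunct2, THEN conjunct1, rule_format, OF U] by blast+
  show "f \<in> reg X U \<Longrightarrow> openin (zar X) V \<Longrightarrow> V \<subseteq> U \<Longrightarrow> f \<in> reg X V"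
    by (rule *[THEN conjunct2, THEN conjunct2, THEN conjunct2, THEN conjunct2, THEN conjunct1, rule_format, OF U])
  show "(\<And>x. x \<in> U \<Longrightarrow> \<exists>V. openin (zar X) V \<and> x \<in> V \<and> V \<subseteq> U \<and> f \<in> reg X V) \<Longrightarrow> f \<in> reg X U"
    by (rule *[THEN conjunct2, THEN conjunct2, THEN conjunct2, THEN conjunct2, THEN conjunct2, rule_format, OF U])
qed

lemma reg_sum:
  assumes "space_with_functions X" "openin (zar X) U" "\<And>i. i \<in> T \<Longrightarrow> f i \<in> reg X U"
  shows "(\<lambda>x. \<Sum>i\<in>T. f i x) \<in> reg X U"
  using assms(3)
  by (induction T rule: infinite_finite_induct) (auto intro: reg_const[OF assms(1,2)] reg_add[OF assms(1,2)])

lemma points_restrict_fspace [simp]: "openin (zar X) U \<Longrightarrow> points (restrict_fspace X U) = U"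
  by (auto simp: restrict_fspace_def dest: openin_subset)

lemma reg_restrict_fspace [simp]: "reg (restrict_fspace X U) = reg X"
  by (simp add: restrict_fspace_def)

lemma openin_restrict_fspace [simp]:
  "openin (zar X) U \<Longrightarrow> openin (zar (restrict_fspace X U)) W \<longleftrightarrow> openin (zar X) W \<and> W \<subseteq> U"
  by (simp add: restrict_fspace_def openin_open_subtopology)

lemma space_with_functions_restrict:
  assumes X: "space_with_functions X" and U: "openin (zar X) U"
  shows "space_with_functions (restrict_fspace X U)"
  unfolding space_with_functions_def openin_restrict_fspace[OF U] reg_restrict_fspace
proof (intro conjI allI impI; (elim conjE)?)
  fix W f g assume W: "openin (zar X) W" and fg: "f \<in> reg X W" "g \<in> reg X W"
  show "f + g \<in> reg X W" using reg_add[OF X W fg] by (simp add: plus_fun_def)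
  show "f * g \<in> reg X W" using reg_mult[OF X W fg] by (simp add: times_fun_def)
next
  fix W f g assume W: "openin (zar X) W" and f: "f \<in> reg X W" and g: "\<forall>x\<in>W. g x = f x"
  show "g \<in> reg X W" by (rule reg_cong[OF X W f]) (use g in blast)
next
  fix W V f assume W: "openin (zar X) W" "openin (zar X) V" "V \<subseteq> W" "f \<in> reg X W"
  show "f \<in> reg X V" by (rule reg_subset[OF X W(1,4,2,3)])
next
  fix W f assume W: "openin (zar X) W"
    and loc: "\<forall>x\<in>W. \<exists>V. (openin (zar X) V \<and> V \<subseteq> U) \<and> x \<in> V \<and> V \<subseteq> W \<and> f \<in> reg X V"
  show "f \<in> reg X W" by (rule reg_local[OF X W]) (use loc in blast)
next
  fix W f assume W: "openin (zar X) W" "W \<subseteq> U" "f \<in> reg X W"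
  show "openin (zar X) {x \<in> W. f x \<noteq> 0}" by (rule openin_reg_nonzero[OF X W(1,3)])
  show "{x \<in> W. f x \<noteq> 0} \<subseteq> U" using W(2) by blast
  show "(\<lambda>x. 1 / f x) \<in> reg X {x \<in> W. f x \<noteq> 0}" by (rule reg_inverse[OF X W(1,3)])
next
  fix W c assume W: "openin (zar X) W"
  show "(\<lambda>_. c) \<in> reg X W" by (rule reg_const[OF X W])
qed

lemma points_affine_space [simp]: "points (affine_space n) = affine_points n"
  and zar_affine_space: "zar (affine_space n) = zariski n"
proof -
  have "topspace (zariski n) = affine_points n"
    unfolding zariski_def topology_generated_by_topspace
  proof (intro equalityI)
    show "affine_points n \<subseteq> \<Union> {basic_open n p |p. p \<in> poly_fun n}"
      by (intro Union_upper CollectI exI[of _ "\<lambda>_. 1"]) (simp add: poly_fun.const)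
  qed blast
  moreover from this show "zar (affine_space n) = zariski n"
    unfolding affine_space_def affine_variety_def using subtopology_topspace[of "zariski n"] by simp
  ultimately show "points (affine_space n) = affine_points n" by simp
qed

lemma openin_basic_open: "p \<in> poly_fun n \<Longrightarrow> openin (zar (affine_space n)) (basic_open n p)"
  unfolding zar_affine_space zariski_def by (rule topology_generated_by_Basis) blast

lemma openin_affine_space_basic:
  assumes "openin (zar (affine_space n)) W" "z \<in> W"
  obtains p where "p \<in> poly_fun n" "p z \<noteq> 0" "basic_open n p \<subseteq> W"
proof -
  have "generate_topology_on {basic_open n p |p. p \<in> poly_fun n} W"
    using assms(1) by (simp add: zar_affine_space zariski_def openin_topology_generated_by_iff)
  then have "\<forall>z\<in>W. \<exists>p\<in>poly_fun n. p z \<noteq> 0 \<and> basic_open n p \<subseteq> W"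
  proof induction
    case Empty then show ?case by simp
  next
    case (Int a b)
    show ?case
    proof
      fix z assume "z \<in> a \<inter> b"
      then obtain p q where "p \<in> poly_fun n" "q \<in> poly_fun n" "p z \<noteq> 0" "q z \<noteq> 0"
        "basic_open n p \<subseteq> a" "basic_open n q \<subseteq> b" using Int.IH by blast
      then show "\<exists>r\<in>poly_fun n. r z \<noteq> 0 \<and> basic_open n r \<subseteq> a \<inter> b"
        by (intro bexI[of _ "\<lambda>z. p z * q z"]) (auto intro: poly_fun.mult)
    qed
  next
    case (UN K) then show ?case by (meson UnionE Union_upper subset_trans)
  next
    case (Basis s) then show ?case by blast
  qed
  then show ?thesis using assms(2) that by blast
qed

text \<open>
  Shrinking the neighbourhood to the principal open set of the product of the denominator and a
  function cutting out the neighbourhood, one polynomial serves both as denominator and as domain.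
\<close>

lemma reg_affine_space_iff:
  assumes "openin (zar (affine_space n)) U"
  shows "f \<in> reg (affine_space n) U \<longleftrightarrow>
    (\<forall>x\<in>U. \<exists>p\<in>poly_fun n. \<exists>q\<in>poly_fun n. q x \<noteq> 0 \<and> basic_open n q \<subseteq> U \<and>
       (\<forall>z\<in>basic_open n q. f z = p z / q z))" (is "?L \<longleftrightarrow> ?R")
proof -
  have "U \<subseteq> affine_points n" using openin_subset[OF assms] by simp
  have L: "?L \<longleftrightarrow> (\<forall>x\<in>U. \<exists>W. \<exists>p\<in>poly_fun n. \<exists>q\<in>poly_fun n.
      openin (zar (affine_space n)) W \<and> x \<in> W \<and> W \<subseteq> U \<and> (\<forall>z\<in>W. q z \<noteq> 0 \<and> f z = p z / q z))"
    by (simp add: affine_space_def affine_variety_def)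
  show ?thesis
  proof
    assume ?L
    show ?R
    proof
      fix x assume x: "x \<in> U"
      obtain W p q where W: "p \<in> poly_fun n" "q \<in> poly_fun n"
        "openin (zar (affine_space n)) W" "x \<in> W" "W \<subseteq> U" "\<And>z. z \<in> W \<Longrightarrow> q z \<noteq> 0 \<and> f z = p z / q z"
        using bspec[OF iffD1[OF L \<open>?L\<close>] x]
        by (elim exE bexE conjE) (rule that; (assumption | erule bspec, assumption))
      obtain g where g: "g \<in> poly_fun n" "g x \<noteq> 0" "basic_open n g \<subseteq> W"
        using openin_affine_space_basic[OF W(3,4)] .
      show "\<exists>p\<in>poly_fun n. \<exists>q\<in>poly_fun n. q x \<noteq> 0 \<and> basic_open n q \<subseteq> U \<and>
         (\<forall>z\<in>basic_open n q. f z = p z / q z)"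
      proof (rule bex2I[of "\<lambda>z. p z * g z" _ "\<lambda>z. q z * g z"]; (intro conjI ballI)?)
        show "q x * g x \<noteq> 0" using W(4,6) g by auto
        show "basic_open n (\<lambda>z. q z * g z) \<subseteq> U" using g W by auto
        fix z assume "z \<in> basic_open n (\<lambda>z. q z * g z)"
        then have "z \<in> W" "g z \<noteq> 0" using g by auto
        then show "f z = p z * g z / (q z * g z)" using W(6) by simp
      qed (intro poly_fun.mult W g)+
    qed
  next
    assume R: ?R
    show ?L unfolding L
    proof
      fix x assume x: "x \<in> U"
      obtain p q where "p \<in> poly_fun n" "q \<in> poly_fun n" "q x \<noteq> 0" "basic_open n q \<subseteq> U"
        "\<forall>z\<in>basic_open n q. f z = p z / q z" using bspec[OF R x]
        by (elim bexE conjE) (rule that; assumption)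
      then show "\<exists>W. \<exists>p\<in>poly_fun n. \<exists>q\<in>poly_fun n.
        openin (zar (affine_space n)) W \<and> x \<in> W \<and> W \<subseteq> U \<and> (\<forall>z\<in>W. q z \<noteq> 0 \<and> f z = p z / q z)"
        using x \<open>U \<subseteq> affine_points n\<close> openin_basic_open[of q n]
        by (intro exI[of _ "basic_open n q"], intro bex2I[of p _ q]) auto
    qed
  qed
qed

lemma reg_affine_space_fraction:
  assumes "openin (zar (affine_space n)) U" "f \<in> reg (affine_space n) U" "x \<in> U"
  obtains p q where "p \<in> poly_fun n" "q \<in> poly_fun n" "q x \<noteq> 0" "basic_open n q \<subseteq> U"
    "\<forall>z\<in>basic_open n q. f z = p z / q z"
  using bspec[OF iffD1[OF reg_affine_space_iff[OF assms(1)] assms(2)] assms(3)]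
  by (elim bexE conjE) (rule that; assumption)

lemma poly_fun_reg_affine_space:
  assumes "openin (zar (affine_space n)) U" "p \<in> poly_fun n"
  shows "p \<in> reg (affine_space n) U"
  unfolding reg_affine_space_iff[OF assms(1)]
proof
  fix x assume "x \<in> U"
  then obtain g where g: "g \<in> poly_fun n" "g x \<noteq> 0" "basic_open n g \<subseteq> U"
    using openin_affine_space_basic[OF assms(1)] by metis
  then show "\<exists>r\<in>poly_fun n. \<exists>q\<in>poly_fun n. q x \<noteq> 0 \<and> basic_open n q \<subseteq> U \<and>
     (\<forall>z\<in>basic_open n q. p z = r z / q z)"
    by (intro bex2I[of "\<lambda>z. p z * g z" _ g] poly_fun.mult assms) auto
qed

lemma space_with_functions_affine_space: "space_with_functions (affine_space n)"
proof -
  let ?A = "affine_space n"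
  have comb: "h \<in> reg ?A U"
    if U: "openin (zar ?A) U" and f: "f \<in> reg ?A U" and g: "g \<in> reg ?A U"
      and h: "\<And>p q p' q'. p \<in> poly_fun n \<Longrightarrow> q \<in> poly_fun n \<Longrightarrow> p' \<in> poly_fun n \<Longrightarrow> q' \<in> poly_fun n \<Longrightarrow>
        \<exists>r\<in>poly_fun n. \<forall>z. q z * q' z \<noteq> 0 \<longrightarrow> f z = p z / q z \<longrightarrow> g z = p' z / q' z \<longrightarrow> h z = r z / (q z * q' z)"
    for U f g h
    unfolding reg_affine_space_iff[OF U]
  proof
    fix x assume x: "x \<in> U"
    obtain p q where p: "p \<in> poly_fun n" "q \<in> poly_fun n" "q x \<noteq> 0" "basic_open n q \<subseteq> U"
      "\<forall>z\<in>basic_open n q. f z = p z / q z" using reg_affine_space_fraction[OF U f x] .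
    obtain p' q' where p': "p' \<in> poly_fun n" "q' \<in> poly_fun n" "q' x \<noteq> 0" "basic_open n q' \<subseteq> U"
      "\<forall>z\<in>basic_open n q'. g z = p' z / q' z" using reg_affine_space_fraction[OF U g x] .
    obtain r where r: "r \<in> poly_fun n" "\<And>z. q z * q' z \<noteq> 0 \<Longrightarrow> f z = p z / q z \<Longrightarrow> g z = p' z / q' z \<Longrightarrow>
        h z = r z / (q z * q' z)" using h[OF p(1,2) p'(1,2)] by blast
    show "\<exists>p\<in>poly_fun n. \<exists>q\<in>poly_fun n. q x \<noteq> 0 \<and> basic_open n q \<subseteq> U \<and>
       (\<forall>z\<in>basic_open n q. h z = p z / q z)"
      using p p' r by (intro bex2I[of r _ "\<lambda>z. q z * q' z"] poly_fun.mult) auto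
  qed
  show ?thesis
    unfolding space_with_functions_def
  proof (intro conjI allI impI)
    fix U f g assume U: "openin (zar ?A) U" and f: "f \<in> reg ?A U" and g: "\<forall>x\<in>U. g x = f x"
    show "g \<in> reg ?A U" unfolding reg_affine_space_iff[OF U]
    proof
      fix x assume x: "x \<in> U"
      obtain p q where "p \<in> poly_fun n" "q \<in> poly_fun n" "q x \<noteq> 0" "basic_open n q \<subseteq> U"
        "\<forall>z\<in>basic_open n q. f z = p z / q z"
        using reg_affine_space_fraction[OF U f x] .
      then show "\<exists>p\<in>poly_fun n. \<exists>q\<in>poly_fun n. q x \<noteq> 0 \<and> basic_open n q \<subseteq> U \<and>
         (\<forall>z\<in>basic_open n q. g z = p z / q z)"
        using g by (intro bex2I[of p _ q]) auto
    qed
  next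
    fix U c assume "openin (zar ?A) U"
    then show "(\<lambda>_. c) \<in> reg ?A U" by (intro poly_fun_reg_affine_space poly_fun.const)
  next
    fix U f g assume U: "openin (zar ?A) U" and f: "f \<in> reg ?A U" and g: "g \<in> reg ?A U"
    show "f + g \<in> reg ?A U"
    proof (rule comb[where U = U and f = f and g = g and h = "f + g", OF U f g])
      fix p q p' q' assume "p \<in> poly_fun n" "q \<in> poly_fun n" "p' \<in> poly_fun n" "q' \<in> poly_fun n"
      then show "\<exists>r\<in>poly_fun n. \<forall>z. q z * q' z \<noteq> 0 \<longrightarrow> f z = p z / q z \<longrightarrow> g z = p' z / q' z \<longrightarrow>
          (f + g) z = r z / (q z * q' z)"
        by (intro bexI[of _ "\<lambda>z. p z * q' z + p' z * q z"] poly_fun.add poly_fun.mult)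
          (auto simp: add_frac_eq)
    qed
    show "f * g \<in> reg ?A U"
    proof (rule comb[where U = U and f = f and g = g and h = "f * g", OF U f g])
      fix p q p' q' assume "p \<in> poly_fun n" "q \<in> poly_fun n" "p' \<in> poly_fun n" "q' \<in> poly_fun n"
      then show "\<exists>r\<in>poly_fun n. \<forall>z. q z * q' z \<noteq> 0 \<longrightarrow> f z = p z / q z \<longrightarrow> g z = p' z / q' z \<longrightarrow>
          (f * g) z = r z / (q z * q' z)"
        by (intro bexI[of _ "\<lambda>z. p z * p' z"] poly_fun.mult) auto
    qed
  next
    fix U f assume U: "openin (zar ?A) U" and f: "f \<in> reg ?A U"
    have loc: "\<exists>p\<in>poly_fun n. \<exists>q\<in>poly_fun n. p x \<noteq> 0 \<and> q x \<noteq> 0 \<and>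
        basic_open n (\<lambda>z. p z * q z) \<subseteq> {x \<in> U. f x \<noteq> 0} \<and>
        (\<forall>z\<in>basic_open n (\<lambda>z. p z * q z). f z = p z / q z)" if x: "x \<in> U" "f x \<noteq> 0" for x
    proof -
      obtain p q where p: "p \<in> poly_fun n" "q \<in> poly_fun n" "q x \<noteq> 0" "basic_open n q \<subseteq> U"
        "\<forall>z\<in>basic_open n q. f z = p z / q z" using reg_affine_space_fraction[OF U f x(1)] .
      have "x \<in> affine_points n" using openin_subset[OF U] x by auto
      then have "p x \<noteq> 0" using p(3,5) x by auto
      then show ?thesis using p by (intro bex2I[of p _ q]) auto
    qed
    show o: "openin (zar ?A) {x \<in> U. f x \<noteq> 0}"
    proof (subst openin_subopen, intro ballI)
      fix x assume x: "x \<in> {x \<in> U. f x \<noteq> 0}"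
      then obtain p q where p: "p \<in> poly_fun n" "q \<in> poly_fun n" "p x \<noteq> 0" "q x \<noteq> 0"
        "basic_open n (\<lambda>z. p z * q z) \<subseteq> {x \<in> U. f x \<noteq> 0}" using loc by blast
      moreover have "x \<in> affine_points n" using openin_subset[OF U] x by auto
      ultimately show "\<exists>T. openin (zar ?A) T \<and> x \<in> T \<and> T \<subseteq> {x \<in> U. f x \<noteq> 0}"
        by (intro exI[of _ "basic_open n (\<lambda>z. p z * q z)"] conjI openin_basic_open poly_fun.mult) auto
    qed
    show "(\<lambda>x. 1 / f x) \<in> reg ?A {x \<in> U. f x \<noteq> 0}"
      unfolding reg_affine_space_iff[OF o]
    proof
      fix x assume x: "x \<in> {x \<in> U. f x \<noteq> 0}"
      then obtain p q where p: "p \<in> poly_fun n" "q \<in> poly_fun n" "p x \<noteq> 0" "q x \<noteq> 0"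
        "basic_open n (\<lambda>z. p z * q z) \<subseteq> {x \<in> U. f x \<noteq> 0}"
        "\<forall>z\<in>basic_open n (\<lambda>z. p z * q z). f z = p z / q z" using loc[of x] by auto
      show "\<exists>r\<in>poly_fun n. \<exists>s\<in>poly_fun n. s x \<noteq> 0 \<and> basic_open n s \<subseteq> {x \<in> U. f x \<noteq> 0} \<and>
          (\<forall>z\<in>basic_open n s. 1 / f z = r z / s z)"
      proof (rule bex2I[of "\<lambda>z. q z * q z" _ "\<lambda>z. p z * q z"]; (intro conjI ballI)?)
        show "p x * q x \<noteq> 0" using p by simp
        show "basic_open n (\<lambda>z. p z * q z) \<subseteq> {x \<in> U. f x \<noteq> 0}" by fact
        fix z assume z: "z \<in> basic_open n (\<lambda>z. p z * q z)"
        then have "f z = p z / q z" using p(6) by blast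
        then show "1 / f z = q z * q z / (p z * q z)" using z by auto
      qed (intro poly_fun.mult p)+
    qed
  next
    fix U V f assume U: "openin (zar ?A) U" and V: "openin (zar ?A) V" "V \<subseteq> U" and f: "f \<in> reg ?A U"
    show "f \<in> reg ?A V" unfolding reg_affine_space_iff[OF V(1)]
    proof
      fix x assume x: "x \<in> V"
      obtain g where g: "g \<in> poly_fun n" "g x \<noteq> 0" "basic_open n g \<subseteq> V"
        using openin_affine_space_basic[OF V(1) x] .
      obtain p q where p: "p \<in> poly_fun n" "q \<in> poly_fun n" "q x \<noteq> 0" "basic_open n q \<subseteq> U"
        "\<forall>z\<in>basic_open n q. f z = p z / q z"
        using reg_affine_space_fraction[OF U f subsetD[OF V(2) x]] .
      show "\<exists>p\<in>poly_fun n. \<exists>q\<in>poly_fun n. q x \<noteq> 0 \<and> basic_open n q \<subseteq> V \<and>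
         (\<forall>z\<in>basic_open n q. f z = p z / q z)"
        using p g by (intro bex2I[of "\<lambda>z. p z * g z" _ "\<lambda>z. q z * g z"] poly_fun.mult) auto
    qed
  next
    fix U f assume U: "openin (zar ?A) U"
      and loc: "\<forall>x\<in>U. \<exists>V. openin (zar ?A) V \<and> x \<in> V \<and> V \<subseteq> U \<and> f \<in> reg ?A V"
    show "f \<in> reg ?A U" unfolding reg_affine_space_iff[OF U]
    proof
      fix x assume "x \<in> U"
      then obtain V where V: "openin (zar ?A) V" "x \<in> V" "V \<subseteq> U" "f \<in> reg ?A V" using loc by blast
      from reg_affine_space_fraction[OF V(1,4,2)]
      obtain p q where "p \<in> poly_fun n" "q \<in> poly_fun n" "q x \<noteq> 0" "basic_open n q \<subseteq> V"
        "\<forall>z\<in>basic_open n q. f z = p z / q z" .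
      then show "\<exists>p\<in>poly_fun n. \<exists>q\<in>poly_fun n. q x \<noteq> 0 \<and> basic_open n q \<subseteq> U \<and>
         (\<forall>z\<in>basic_open n q. f z = p z / q z)"
        using V(3) by (intro bex2I[of p _ q]) auto
    qed
  qed
qed

section \<open>Morphisms\<close>

lemma
  assumes "morphism X Y f"
  shows morphism_points: "x \<in> points X \<Longrightarrow> f x \<in> points Y"
    and openin_morphism_preimage: "openin (zar Y) V \<Longrightarrow> openin (zar X) {x \<in> points X. f x \<in> V}"
    and reg_morphism_pullback:
      "openin (zar Y) V \<Longrightarrow> g \<in> reg Y V \<Longrightarrow> (\<lambda>x. g (f x)) \<in> reg X {x \<in> points X. f x \<in> V}"
  using assms by (auto simp: morphism_def continuous_map_def comp_def)

lemma morphismI: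
  assumes "\<And>x. x \<in> points X \<Longrightarrow> f x \<in> points Y"
    and "\<And>V. openin (zar Y) V \<Longrightarrow> openin (zar X) {x \<in> points X. f x \<in> V}"
    and "\<And>V g. openin (zar Y) V \<Longrightarrow> g \<in> reg Y V \<Longrightarrow> (\<lambda>x. g (f x)) \<in> reg X {x \<in> points X. f x \<in> V}"
  shows "morphism X Y f"
  using assms by (auto simp: morphism_def continuous_map_def comp_def)

lemma morphism_compose:
  assumes f: "morphism X Y f" and g: "morphism Y Z g"
  shows "morphism X Z (\<lambda>x. g (f x))"
proof -
  have eq: "{x \<in> points X. g (f x) \<in> V} = {x \<in> points X. f x \<in> {y \<in> points Y. g y \<in> V}}" for V
    using morphism_points[OF f] by auto
  show ?thesis
  proof (rule morphismI)
    fix V h assume V: "openin (zar Z) V"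
    show "openin (zar X) {x \<in> points X. g (f x) \<in> V}"
      unfolding eq by (intro openin_morphism_preimage[OF f] openin_morphism_preimage[OF g] V)
    assume "h \<in> reg Z V"
    from reg_morphism_pullback[OF f openin_morphism_preimage[OF g V] reg_morphism_pullback[OF g V this]]
    show "(\<lambda>x. h (g (f x))) \<in> reg X {x \<in> points X. g (f x) \<in> V}" unfolding eq .
  qed (auto intro: morphism_points[OF f] morphism_points[OF g])
qed

lemma morphism_cong:
  assumes X: "space_with_functions X" and f: "morphism X Y f" and g: "\<And>x. x \<in> points X \<Longrightarrow> g x = f x"
  shows "morphism X Y g"
proof -
  have eq: "{x \<in> points X. g x \<in> V} = {x \<in> points X. f x \<in> V}" for V using g by auto
  show ?thesis
  proof (rule morphismI)
    fix V h assume V: "openin (zar Y) V"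
    show "openin (zar X) {x \<in> points X. g x \<in> V}"
      unfolding eq by (rule openin_morphism_preimage[OF f V])
    assume "h \<in> reg Y V"
    from reg_morphism_pullback[OF f V this] show "(\<lambda>x. h (g x)) \<in> reg X {x \<in> points X. g x \<in> V}"
      unfolding eq by (rule reg_cong[OF X openin_morphism_preimage[OF f V]]) (simp add: g)
  qed (auto simp: g morphism_points[OF f])
qed

lemma morphism_id: "morphism X X (\<lambda>x. x)"
proof -
  have "{x \<in> points X. x \<in> V} = V" if "openin (zar X) V" for V
    using openin_subset[OF that] by blast
  then show ?thesis by (intro morphismI) simp_all
qed

lemma morphism_const:
  assumes X: "space_with_functions X" and "y \<in> points Y"
  shows "morphism X Y (\<lambda>_. y)"
proof (rule morphismI)
  have eq: "{x \<in> points X. y \<in> V} = (if y \<in> V then points X else {})" for V by auto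
  fix V show o: "openin (zar X) {x \<in> points X. y \<in> V}" by (simp add: eq)
  fix h show "(\<lambda>_. h y) \<in> reg X {x \<in> points X. y \<in> V}" by (rule reg_const[OF X o])
qed (use assms in auto)

lemma morphism_restrict_source:
  assumes X: "space_with_functions X" and U: "openin (zar X) U" and f: "morphism X Y f"
  shows "morphism (restrict_fspace X U) Y f"
proof -
  have Us: "U \<subseteq> points X" using openin_subset[OF U] .
  have eq: "{x \<in> U. f x \<in> V} = U \<inter> {x \<in> points X. f x \<in> V}" for V using Us by auto
  show ?thesis
  proof (rule morphismI; (unfold points_restrict_fspace[OF U] reg_restrict_fspace openin_restrict_fspace[OF U])?)
    fix V h assume V: "openin (zar Y) V"
    have o: "openin (zar X) {x \<in> U. f x \<in> V}"
      unfolding eq by (intro openin_Int U openin_morphism_preimage[OF f] V)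
    then show "openin (zar X) {x \<in> U. f x \<in> V} \<and> {x \<in> U. f x \<in> V} \<subseteq> U" by auto
    assume "h \<in> reg Y V"
    from reg_morphism_pullback[OF f V this] show "(\<lambda>x. h (f x)) \<in> reg X {x \<in> U. f x \<in> V}"
      by (rule reg_subset[OF X openin_morphism_preimage[OF f V]]) (use o Us in auto)
  qed (use Us morphism_points[OF f] in auto)
qed

lemma morphism_restrict_target:
  assumes U: "openin (zar Y) U" and f: "morphism X Y f" and fU: "\<And>x. x \<in> points X \<Longrightarrow> f x \<in> U"
  shows "morphism X (restrict_fspace Y U) f"
  by (rule morphismI; (unfold points_restrict_fspace[OF U] reg_restrict_fspace openin_restrict_fspace[OF U])?)
    (auto simp: fU intro: openin_morphism_preimage[OF f] reg_morphism_pullback[OF f])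

lemma morphism_extend_target:
  assumes Y: "space_with_functions Y" and U: "openin (zar Y) U"
    and f: "morphism X (restrict_fspace Y U) f"
  shows "morphism X Y f"
proof -
  have fU: "f x \<in> U" if "x \<in> points X" for x
    using morphism_points[OF f that] by (simp add: U)
  have eq: "{x \<in> points X. f x \<in> V} = {x \<in> points X. f x \<in> V \<inter> U}" for V
    using fU by auto
  show ?thesis
  proof (rule morphismI)
    fix V h assume V: "openin (zar Y) V"
    have VU: "openin (zar (restrict_fspace Y U)) (V \<inter> U)" using U V by (simp add: openin_Int)
    show "openin (zar X) {x \<in> points X. f x \<in> V}"
      unfolding eq[of V] by (rule openin_morphism_preimage[OF f VU])
    assume "h \<in> reg Y V"
    then have "h \<in> reg Y (V \<inter> U)" by (rule reg_subset[OF Y V]) (use U V in \<open>auto simp: openin_Int\<close>)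
    then show "(\<lambda>x. h (f x)) \<in> reg X {x \<in> points X. f x \<in> V}"
      unfolding eq[of V] using reg_morphism_pullback[OF f VU] by simp
  qed (use fU openin_subset[OF U] in auto)
qed

lemma morphism_local:
  assumes X: "space_with_functions X"
    and loc: "\<And>x. x \<in> points X \<Longrightarrow> \<exists>U. openin (zar X) U \<and> x \<in> U \<and> morphism (restrict_fspace X U) Y f"
  shows "morphism X Y f"
proof -
  have nbhd: "\<exists>T. openin (zar X) T \<and> x \<in> T \<and> T \<subseteq> {x \<in> points X. f x \<in> V} \<and>
      (\<forall>h\<in>reg Y V. (\<lambda>x. h (f x)) \<in> reg X T)"
    if x: "x \<in> {x \<in> points X. f x \<in> V}" and V: "openin (zar Y) V" for x V
  proof -
    obtain U where U: "openin (zar X) U" "x \<in> U" "morphism (restrict_fspace X U) Y f"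
      using loc x by blast
    have "openin (zar X) {w \<in> U. f w \<in> V}"
      using openin_morphism_preimage[OF U(3) V] by (simp add: U(1))
    moreover have "(\<lambda>x. h (f x)) \<in> reg X {w \<in> U. f w \<in> V}" if "h \<in> reg Y V" for h
      using reg_morphism_pullback[OF U(3) V that] by (simp add: U(1))
    ultimately show ?thesis
      using x U(2) openin_subset[OF U(1)] by (intro exI[of _ "{w \<in> U. f w \<in> V}"]) auto
  qed
  show ?thesis
  proof (rule morphismI)
    fix x assume "x \<in> points X"
    then obtain U where U: "openin (zar X) U" "x \<in> U" "morphism (restrict_fspace X U) Y f"
      using loc by blast
    then show "f x \<in> points Y" using morphism_points[OF U(3), of x] by simp
  next
    fix V h assume V: "openin (zar Y) V"
    show o: "openin (zar X) {x \<in> points X. f x \<in> V}"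
      by (subst openin_subopen) (use nbhd[OF _ V] in blast)
    assume h: "h \<in> reg Y V"
    show "(\<lambda>x. h (f x)) \<in> reg X {x \<in> points X. f x \<in> V}"
      by (rule reg_local[OF X o]) (use nbhd[OF _ V] h in blast)
  qed
qed

lemma reg_poly_fun_compose:
  assumes X: "space_with_functions X" and U: "openin (zar X) U"
    and m: "\<And>i. i < r \<Longrightarrow> (\<lambda>x. m x i) \<in> reg X U" and p: "p \<in> poly_fun r"
  shows "(\<lambda>x. p (m x)) \<in> reg X U"
  using p by induction (auto intro: reg_const[OF X U] reg_add[OF X U] reg_mult[OF X U] m)

lemma morphism_into_affine_space:
  assumes X: "space_with_functions X" and mA: "\<And>x. x \<in> points X \<Longrightarrow> m x \<in> affine_points r"
    and m: "\<And>i. i < r \<Longrightarrow> (\<lambda>x. m x i) \<in> reg X (points X)"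
  shows "morphism X (affine_space r) m"
proof -
  have P: "(\<lambda>x. p (m x)) \<in> reg X (points X)" if "p \<in> poly_fun r" for p
    by (rule reg_poly_fun_compose[OF X openin_topspace m that])
  have basic: "openin (zar X) {x \<in> points X. p (m x) \<noteq> 0}" if "p \<in> poly_fun r" for p
    by (rule openin_reg_nonzero[OF X openin_topspace P[OF that]])
  have quot: "(\<lambda>x. p (m x) / q (m x)) \<in> reg X {x \<in> points X. q (m x) \<noteq> 0}"
    if p: "p \<in> poly_fun r" and q: "q \<in> poly_fun r" for p q
  proof -
    have "(\<lambda>x. p (m x) * (1 / q (m x))) \<in> reg X {x \<in> points X. q (m x) \<noteq> 0}"
      by (intro reg_mult[OF X basic[OF q]] reg_inverse[OF X openin_topspace P[OF q]]
          reg_subset[OF X openin_topspace P[OF p] basic[OF q]]) auto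
    then show ?thesis by simp
  qed
  show ?thesis
  proof (rule morphismI)
    fix V h assume V: "openin (zar (affine_space r)) V"
    show o: "openin (zar X) {x \<in> points X. m x \<in> V}"
    proof (subst openin_subopen, intro ballI)
      fix x assume x: "x \<in> {x \<in> points X. m x \<in> V}"
      then obtain p where "p \<in> poly_fun r" "p (m x) \<noteq> 0" "basic_open r p \<subseteq> V"
        using openin_affine_space_basic[OF V] by blast
      then show "\<exists>T. openin (zar X) T \<and> x \<in> T \<and> T \<subseteq> {x \<in> points X. m x \<in> V}"
        using x mA basic by (intro exI[of _ "{x \<in> points X. p (m x) \<noteq> 0}"]) auto
    qed
    assume h: "h \<in> reg (affine_space r) V"
    show "(\<lambda>x. h (m x)) \<in> reg X {x \<in> points X. m x \<in> V}"
    proof (rule reg_local[OF X o])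
      fix x assume x: "x \<in> {x \<in> points X. m x \<in> V}"
      then have "m x \<in> V" by simp
      from reg_affine_space_fraction[OF V h this]
      obtain p q where p: "p \<in> poly_fun r" "q \<in> poly_fun r" "q (m x) \<noteq> 0" "basic_open r q \<subseteq> V"
        "\<forall>z\<in>basic_open r q. h z = p z / q z" .
      have "(\<lambda>x. h (m x)) \<in> reg X {x \<in> points X. q (m x) \<noteq> 0}"
        by (rule reg_cong[OF X basic[OF p(2)] quot[OF p(1,2)]]) (use p mA in auto)
      then show "\<exists>T. openin (zar X) T \<and> x \<in> T \<and> T \<subseteq> {x \<in> points X. m x \<in> V} \<and> (\<lambda>x. h (m x)) \<in> reg X T"
        using x mA basic p by (intro exI[of _ "{x \<in> points X. q (m x) \<noteq> 0}"]) auto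
    qed
  qed (use mA in auto)
qed

lemma morphism_affine_coord:
  assumes m: "morphism X (affine_space r) m" and "i < r"
  shows "(\<lambda>x. m x i) \<in> reg X (points X)"
proof -
  have "(\<lambda>x. m x i) \<in> reg X {x \<in> points X. m x \<in> points (affine_space r)}"
    by (rule reg_morphism_pullback[OF m openin_topspace])
      (intro poly_fun_reg_affine_space openin_topspace poly_fun.coord assms)
  moreover have "{x \<in> points X. m x \<in> points (affine_space r)} = points X"
    using morphism_points[OF m] by auto
  ultimately show ?thesis by simp
qed

lemma elementary_tensor:
  assumes "f \<in> reg P U" "g \<in> reg Q V"
  shows "(\<lambda>w. f (fst w) * g (snd w)) \<in> tensor_functions P Q U V"
  unfolding tensor_functions_def mem_Collect_eq
  by (rule exI[of _ "1::nat"], rule exI[of _ "\<lambda>_. f"], rule exI[of _ "\<lambda>_. g"]) (use assms in auto)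

lemma const_in_tensor_functions:
  assumes "space_with_functions P" "space_with_functions Q" "openin (zar P) U" "openin (zar Q) V"
  shows "(\<lambda>_. c) \<in> tensor_functions P Q U V"
  using elementary_tensor[OF reg_const[OF assms(1,3), of c] reg_const[OF assms(2,4), of 1]] by simp

lemma topspace_prod_zariski:
  assumes "space_with_functions P" "space_with_functions Q"
  shows "topspace (prod_zariski P Q) = points P \<times> points Q"
proof
  show "topspace (prod_zariski P Q) \<subseteq> points P \<times> points Q"
    unfolding prod_zariski_def topology_generated_by_topspace
    by (auto dest!: openin_subset)
  have "(\<lambda>_. 1) \<in> tensor_functions P Q (points P) (points Q)"
    by (intro const_in_tensor_functions assms openin_topspace)
  then show "points P \<times> points Q \<subseteq> topspace (prod_zariski P Q)"
    unfolding prod_zariski_def topology_generated_by_topspace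
    by - (intro Union_upper CollectI, rule exI[of _ "points P"], rule exI[of _ "points Q"],
        rule exI[of _ "\<lambda>_. 1"], auto)
qed

text \<open>
  A tensor \<open>\<Sum>i<k. f i \<otimes> g i\<close> pulls back to \<open>\<Sum>i<k. (f i \<circ> a) * (g i \<circ> b)\<close>, which is regular. As the
  topology and the functions of the product are generated by tensors, nothing else has to be checked.
\<close>

lemma morphism_pair:
  assumes S: "space_with_functions S" and P: "space_with_functions P" and Q: "space_with_functions Q"
    and a: "morphism S P a" and b: "morphism S Q b"
  shows "morphism S (prod_fspace P Q) (\<lambda>x. (a x, b x))"
proof -
  define R where "R U V = {x \<in> points S. a x \<in> U} \<inter> {x \<in> points S. b x \<in> V}" for U V
  have Ro: "openin (zar S) (R U V)" if "openin (zar P) U" "openin (zar Q) V" for U V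
    unfolding R_def by (intro openin_Int openin_morphism_preimage[OF a] openin_morphism_preimage[OF b] that)
  have T: "(\<lambda>x. h (a x, b x)) \<in> reg S (R U V)"
    if UV: "openin (zar P) U" "openin (zar Q) V" and h: "h \<in> tensor_functions P Q U V" for U V h
  proof -
    obtain k f g where h: "h = (\<lambda>(x, y). \<Sum>i<(k::nat). f i x * g i y)"
      and fg: "\<And>i. i < k \<Longrightarrow> f i \<in> reg P U" "\<And>i. i < k \<Longrightarrow> g i \<in> reg Q V"
      using h unfolding tensor_functions_def by blast
    have "(\<lambda>x. \<Sum>i<k. f i (a x) * g i (b x)) \<in> reg S (R U V)"
    proof (intro reg_sum[OF S Ro[OF UV]] reg_mult[OF S Ro[OF UV]])
      fix i assume "i \<in> {..<k}"
      then have i: "i < k" by simp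
      show "(\<lambda>x. f i (a x)) \<in> reg S (R U V)"
        by (rule reg_subset[OF S openin_morphism_preimage[OF a UV(1)] reg_morphism_pullback[OF a UV(1) fg(1)[OF i]] Ro[OF UV]])
          (auto simp: R_def)
      show "(\<lambda>x. g i (b x)) \<in> reg S (R U V)"
        by (rule reg_subset[OF S openin_morphism_preimage[OF b UV(2)] reg_morphism_pullback[OF b UV(2) fg(2)[OF i]] Ro[OF UV]])
          (auto simp: R_def)
    qed
    then show ?thesis by (simp add: h)
  qed
  have pts: "(a x, b x) \<in> points P \<times> points Q" if "x \<in> points S" for x
    using morphism_points[OF a that] morphism_points[OF b that] by simp
  have cont: "continuous_map (zar S) (prod_zariski P Q) (\<lambda>x. (a x, b x))"
    unfolding prod_zariski_def
  proof (rule continuous_on_generated_topo)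
    fix D assume "D \<in> {{w \<in> U \<times> V. h w \<noteq> 0} |U V h.
        openin (zar P) U \<and> openin (zar Q) V \<and> h \<in> tensor_functions P Q U V}"
    then obtain U V h where D: "D = {w \<in> U \<times> V. h w \<noteq> 0}" and UV: "openin (zar P) U" "openin (zar Q) V"
      and h: "h \<in> tensor_functions P Q U V" by blast
    have "(\<lambda>x. (a x, b x)) -` D \<inter> topspace (zar S) = {x \<in> R U V. h (a x, b x) \<noteq> 0}"
      by (auto simp: D R_def)
    then show "openin (zar S) ((\<lambda>x. (a x, b x)) -` D \<inter> topspace (zar S))"
      using openin_reg_nonzero[OF S Ro[OF UV] T[OF UV h]] by simp
  next
    show "(\<lambda>x. (a x, b x)) ` topspace (zar S) \<subseteq> \<Union> {{w \<in> U \<times> V. h w \<noteq> 0} |U V h.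
        openin (zar P) U \<and> openin (zar Q) V \<and> h \<in> tensor_functions P Q U V}"
      using pts topspace_prod_zariski[OF P Q]
      unfolding prod_zariski_def topology_generated_by_topspace by blast
  qed
  have zar: "zar (prod_fspace P Q) = prod_zariski P Q" by (simp add: prod_fspace_def)
  show ?thesis
  proof (rule morphismI; (unfold zar)?)
    fix x assume "x \<in> points S"
    then show "(a x, b x) \<in> topspace (prod_zariski P Q)"
      using pts topspace_prod_zariski[OF P Q] by simp
  next
    fix D h assume D: "openin (prod_zariski P Q) D"
    have pre: "openin (zar S) {x \<in> points S. (a x, b x) \<in> W}" if "openin (prod_zariski P Q) W" for W
      using cont that by (auto simp: continuous_map_def)
    show "openin (zar S) {x \<in> points S. (a x, b x) \<in> D}" by (rule pre[OF D])
    assume h: "h \<in> reg (prod_fspace P Q) D"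
    show "(\<lambda>x. h (a x, b x)) \<in> reg S {x \<in> points S. (a x, b x) \<in> D}"
    proof (rule reg_local[OF S pre[OF D]])
      fix x assume x: "x \<in> {x \<in> points S. (a x, b x) \<in> D}"
      then obtain U V W c d where cd: "c \<in> tensor_functions P Q U V" "d \<in> tensor_functions P Q U V"
        and UV: "openin (zar P) U" "openin (zar Q) V" and W: "openin (prod_zariski P Q) W"
        "(a x, b x) \<in> W" "W \<subseteq> D \<inter> (U \<times> V)" "\<And>v. v \<in> W \<Longrightarrow> d v \<noteq> 0 \<and> h v = c v / d v"
        using h unfolding prod_fspace_def by auto
      let ?W = "{x \<in> points S. (a x, b x) \<in> W}"
      let ?E = "{x \<in> R U V. d (a x, b x) \<noteq> 0}"
      have E: "openin (zar S) ?E" by (rule openin_reg_nonzero[OF S Ro[OF UV] T[OF UV cd(2)]])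
      have WE: "?W \<subseteq> ?E" "?W \<subseteq> R U V" using W by (auto simp: R_def)
      have "(\<lambda>x. c (a x, b x) * (1 / d (a x, b x))) \<in> reg S ?W"
        by (intro reg_mult[OF S pre[OF W(1)]]
            reg_subset[OF S Ro[OF UV] T[OF UV cd(1)] pre[OF W(1)] WE(2)]
            reg_subset[OF S E reg_inverse[OF S Ro[OF UV] T[OF UV cd(2)]] pre[OF W(1)] WE(1)])
      then have "(\<lambda>x. h (a x, b x)) \<in> reg S ?W"
        by (rule reg_cong[OF S pre[OF W(1)]]) (use W in auto)
      then show "\<exists>T. openin (zar S) T \<and> x \<in> T \<and> T \<subseteq> {x \<in> points S. (a x, b x) \<in> D} \<and>
          (\<lambda>x. h (a x, b x)) \<in> reg S T"
        using x W pre[OF W(1)] by (intro exI[of _ ?W]) auto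
    qed
  qed
qed

lemma morphism_snd:
  assumes P: "space_with_functions P" and Q: "space_with_functions Q"
  shows "morphism (prod_fspace P Q) Q snd"
proof -
  have zar: "zar (prod_fspace P Q) = prod_zariski P Q" by (simp add: prod_fspace_def)
  have eq: "{w \<in> topspace (prod_zariski P Q). snd w \<in> V} = {w \<in> points P \<times> V. (1::complex) \<noteq> 0}"
    if "openin (zar Q) V" for V
    using openin_subset[OF that] by (auto simp: topspace_prod_zariski[OF P Q])
  have one: "(\<lambda>_. 1) \<in> tensor_functions P Q (points P) V" if "openin (zar Q) V" for V
    by (intro const_in_tensor_functions P Q that openin_topspace)
  show ?thesis
  proof (rule morphismI; (unfold zar)?)
    fix w assume "w \<in> topspace (prod_zariski P Q)"
    then show "snd w \<in> points Q" by (auto simp: topspace_prod_zariski[OF P Q])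
  next
    fix V h assume V: "openin (zar Q) V"
    show o: "openin (prod_zariski P Q) {w \<in> topspace (prod_zariski P Q). snd w \<in> V}"
      unfolding eq[OF V] unfolding prod_zariski_def
      by (rule topology_generated_by_Basis, rule CollectI, rule exI[of _ "points P"],
          rule exI[of _ V], rule exI[of _ "\<lambda>_. 1"]) (use V one[OF V] in auto)
    assume h: "h \<in> reg Q V"
    have t: "(\<lambda>w. h (snd w)) \<in> tensor_functions P Q (points P) V"
      using elementary_tensor[OF reg_const[OF P openin_topspace, of 1] h] by simp
    show "(\<lambda>w. h (snd w)) \<in> reg (prod_fspace P Q) {w \<in> topspace (prod_zariski P Q). snd w \<in> V}"
      unfolding prod_fspace_def fspace.select_convs
    proof (intro CollectI ballI)
      fix w assume w: "w \<in> {w \<in> topspace (prod_zariski P Q). snd w \<in> V}"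
      show "\<exists>U V' W. \<exists>a\<in>tensor_functions P Q U V'. \<exists>b\<in>tensor_functions P Q U V'.
          openin (zar P) U \<and> openin (zar Q) V' \<and> openin (prod_zariski P Q) W \<and> w \<in> W \<and>
          W \<subseteq> {w \<in> topspace (prod_zariski P Q). snd w \<in> V} \<inter> (U \<times> V') \<and>
          (\<forall>v\<in>W. b v \<noteq> 0 \<and> h (snd v) = a v / b v)"
        by (rule exI[of _ "points P"], rule exI[of _ V],
            rule exI[of _ "{w \<in> topspace (prod_zariski P Q). snd w \<in> V}"],
            rule bex2I[OF t one[OF V]])
          (use w o V in \<open>auto simp: topspace_prod_zariski[OF P Q]\<close>)
    qed
  qed
qed

section \<open>Regular functions on principal open sets\<close>

text \<open>
  The denominators that make \<open>u\<close> polynomial on the set \<open>H \<noteq> 0\<close> form an ideal. Its zeros lie on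
  \<open>H = 0\<close>, since \<open>u\<close> is locally a fraction, so the ideal contains a power of \<open>H\<close>.
  All large exponents are admitted so that finitely many functions can share one.
\<close>

lemma regular_on_basic_open:
  assumes H: "H \<in> poly_fun n" and u: "u \<in> reg (affine_space n) (basic_open n H)"
  shows "\<forall>\<^sub>F N in sequentially. \<exists>p\<in>poly_fun n. \<forall>z\<in>basic_open n H. H z ^ N * u z = p z"
proof -
  define I where "I = {q \<in> poly_fun n. \<exists>p\<in>poly_fun n. \<forall>z\<in>basic_open n H. q z * u z = p z}"
  have "poly_ideal n I"
    unfolding poly_ideal_def
  proof (intro conjI ballI)
    show "I \<subseteq> poly_fun n" by (auto simp: I_def)
    show "(\<lambda>_. 0) \<in> I"
      unfolding I_def by (intro CollectI conjI poly_fun.const bexI[of _ "\<lambda>_. 0"]) auto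
  next
    fix q q' assume "q \<in> I" "q' \<in> I"
    then obtain p p' where *: "q \<in> poly_fun n" "q' \<in> poly_fun n" "p \<in> poly_fun n" "p' \<in> poly_fun n"
      "\<forall>z\<in>basic_open n H. q z * u z = p z" "\<forall>z\<in>basic_open n H. q' z * u z = p' z"
      unfolding I_def by blast
    show "(\<lambda>z. q z + q' z) \<in> I"
      unfolding I_def using *
      by (intro CollectI conjI poly_fun.add bexI[of _ "\<lambda>z. p z + p' z"]) (auto simp: algebra_simps)
  next
    fix a q assume a: "a \<in> poly_fun n" and "q \<in> I"
    then obtain p where *: "q \<in> poly_fun n" "p \<in> poly_fun n" "\<forall>z\<in>basic_open n H. q z * u z = p z"
      unfolding I_def by blast
    show "(\<lambda>z. a z * q z) \<in> I"
      unfolding I_def using a *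
      by (intro CollectI conjI poly_fun.mult bexI[of _ "\<lambda>z. a z * p z"]) auto
  qed
  moreover have "H z = 0" if z: "z \<in> affine_points n" and "\<And>q. q \<in> I \<Longrightarrow> q z = 0" for z
  proof (rule ccontr)
    assume "H z \<noteq> 0"
    then have "z \<in> basic_open n H" using z by simp
    from reg_affine_space_fraction[OF openin_basic_open[OF H] u this]
    obtain p q where pq: "p \<in> poly_fun n" "q \<in> poly_fun n" "q z \<noteq> 0"
      "\<forall>w\<in>basic_open n q. u w = p w / q w" .
    \<comment> \<open>Squaring the denominator makes the identity hold where it vanishes as well.\<close>
    have "q w * q w * u w = p w * q w" if "w \<in> basic_open n H" for w
      using pq(4) that by (cases "q w = 0") auto
    then have "(\<lambda>w. q w * q w) \<in> I"
      unfolding I_def by (intro CollectI conjI bexI[of _ "\<lambda>w. p w * q w"] poly_fun.mult pq) auto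
    with that(2) have "q z * q z = 0" by blast
    then show False using pq(3) by simp
  qed
  ultimately obtain N where "(\<lambda>z. H z ^ N) \<in> I" using nullstellensatz[OF _ H] by blast
  then obtain p where p: "p \<in> poly_fun n" "\<And>z. z \<in> basic_open n H \<Longrightarrow> H z ^ N * u z = p z"
    unfolding I_def by blast
  show ?thesis
    unfolding eventually_sequentially
  proof (intro exI[of _ N] allI impI)
    fix M assume "N \<le> M"
    then have "H z ^ M = H z ^ (M - N) * H z ^ N" for z by (simp flip: power_add)
    then show "\<exists>p\<in>poly_fun n. \<forall>z\<in>basic_open n H. H z ^ M * u z = p z"
      using p by (intro bexI[of _ "\<lambda>z. H z ^ (M - N) * p z"] poly_fun.mult poly_fun_power H) auto
  qed
qed

text \<open>
  After multiplication by a power of \<open>g\<close> the difference \<open>u - v\<close> is a polynomial whose product with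
  \<open>h * g\<close> vanishes identically.
\<close>

lemma regular_eq_of_eq_dense:
  assumes g: "g \<in> poly_fun n" and h: "h \<in> poly_fun n" and w: "w \<in> affine_points n" "h w \<noteq> 0"
    and u: "u \<in> reg (affine_space n) (basic_open n g)" and v: "v \<in> reg (affine_space n) (basic_open n g)"
    and eq: "\<And>z. z \<in> basic_open n g \<Longrightarrow> h z \<noteq> 0 \<Longrightarrow> u z = v z"
    and z: "z \<in> basic_open n g"
  shows "u z = v z"
proof -
  obtain N p q where p: "p \<in> poly_fun n" "\<And>z. z \<in> basic_open n g \<Longrightarrow> g z ^ N * u z = p z"
    and q: "q \<in> poly_fun n" "\<And>z. z \<in> basic_open n g \<Longrightarrow> g z ^ N * v z = q z"
    using eventually_happens'[OF sequentially_bot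
        eventually_conj[OF regular_on_basic_open[OF g u] regular_on_basic_open[OF g v]]] by blast
  have hg: "(\<lambda>z. h z * g z) \<in> poly_fun n" by (intro poly_fun.mult h g)
  obtain w' where w': "w' \<in> affine_points n" "h w' * g w' \<noteq> 0"
    using poly_fun_no_zero_divisors[OF h g, of z w] w z by auto
  have "p z - q z = 0"
  proof (rule poly_fun_no_zero_divisors[OF poly_fun_diff[OF p(1) q(1)] hg _ w'])
    fix z assume z: "z \<in> affine_points n"
    show "(p z - q z) * (h z * g z) = 0"
    proof (cases "g z = 0 \<or> h z = 0")
      case False
      then have "z \<in> basic_open n g" using z by simp
      then show ?thesis using p(2)[of z] q(2)[of z] eq[of z] False by auto
    qed auto
  qed (use z in simp)
  then have "g z ^ N * u z = g z ^ N * v z" using p(2)[OF z] q(2)[OF z] by simp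
  then show ?thesis using z by simp
qed

lemma morphism_into_affine_space_eq_of_eq_dense:
  assumes g: "g \<in> poly_fun n" and h: "h \<in> poly_fun n" and w: "w \<in> affine_points n" "h w \<noteq> 0"
    and a: "morphism (restrict_fspace (affine_space n) (basic_open n g)) (affine_space r) a"
    and b: "morphism (restrict_fspace (affine_space n) (basic_open n g)) (affine_space r) b"
    and eq: "\<And>z. z \<in> basic_open n g \<Longrightarrow> h z \<noteq> 0 \<Longrightarrow> a z = b z"
    and z: "z \<in> basic_open n g"
  shows "a z = b z"
proof
  note o = openin_basic_open[OF g]
  fix i
  show "a z i = b z i"
  proof (cases "i < r")
    case True
    have "(\<lambda>z. a z i) \<in> reg (affine_space n) (basic_open n g)"
      "(\<lambda>z. b z i) \<in> reg (affine_space n) (basic_open n g)"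
      using morphism_affine_coord[OF a True] morphism_affine_coord[OF b True] by (simp_all add: o)
    from regular_eq_of_eq_dense[OF g h w this _ z] eq show ?thesis by simp
  next
    case False
    have "z \<in> points (restrict_fspace (affine_space n) (basic_open n g))"
      using z by (simp only: points_restrict_fspace[OF o])
    from morphism_points[OF a this] morphism_points[OF b this]
    show ?thesis using False by (simp add: affine_points_def)
  qed
qed

text \<open>
  The polynomials that vanish wherever some finite part of \<open>G\<close> vanishes form an ideal without zeros,
  which therefore contains \<open>1\<close>.
\<close>

lemma finite_basic_open_subcover:
  assumes G: "G \<subseteq> poly_fun n" and cover: "\<And>z. z \<in> affine_points n \<Longrightarrow> \<exists>g\<in>G. g z \<noteq> 0"
  obtains K where "finite K" "K \<subseteq> G" "\<And>z. z \<in> affine_points n \<Longrightarrow> \<exists>g\<in>K. g z \<noteq> 0"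
proof -
  define I where "I = {p \<in> poly_fun n. \<exists>K. finite K \<and> K \<subseteq> G \<and>
    (\<forall>z\<in>affine_points n. (\<forall>g\<in>K. g z = 0) \<longrightarrow> p z = 0)}"
  have "poly_ideal n I"
    unfolding poly_ideal_def
  proof (intro conjI ballI)
    show "I \<subseteq> poly_fun n" by (auto simp: I_def)
    show "(\<lambda>_. 0) \<in> I" unfolding I_def by (auto intro: poly_fun.const)
  next
    fix p q assume "p \<in> I" "q \<in> I"
    then obtain K L where *: "p \<in> poly_fun n" "q \<in> poly_fun n" "finite K" "K \<subseteq> G" "finite L" "L \<subseteq> G"
      "\<forall>z\<in>affine_points n. (\<forall>g\<in>K. g z = 0) \<longrightarrow> p z = 0"
      "\<forall>z\<in>affine_points n. (\<forall>g\<in>L. g z = 0) \<longrightarrow> q z = 0" unfolding I_def by blast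
    then show "(\<lambda>z. p z + q z) \<in> I"
      unfolding I_def by (intro CollectI conjI poly_fun.add exI[of _ "K \<union> L"]) auto
  next
    fix a p assume "a \<in> poly_fun n" "p \<in> I"
    then show "(\<lambda>z. a z * p z) \<in> I"
      unfolding I_def by (auto intro: poly_fun.mult)
  qed
  moreover have "(1::complex) = 0" if "z \<in> affine_points n" "\<And>p. p \<in> I \<Longrightarrow> p z = 0" for z
  proof -
    obtain g where g: "g \<in> G" "g z \<noteq> 0" using cover \<open>z \<in> affine_points n\<close> by blast
    then have "g \<in> I" using G unfolding I_def by (auto intro!: exI[of _ "{g}"])
    then show ?thesis using that(2) g by blast
  qed
  ultimately have "\<exists>N. (\<lambda>z. (1::complex) ^ N) \<in> I"
    by (rule nullstellensatz[OF _ poly_fun.const])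
  then obtain K where "finite K" "K \<subseteq> G" "\<forall>z\<in>affine_points n. (\<forall>g\<in>K. g z = 0) \<longrightarrow> (1::complex) = 0"
    unfolding I_def by auto
  then show ?thesis using that by auto
qed

lemma reg_poly_fun_over_power:
  assumes p: "p \<in> poly_fun n" and g: "g \<in> poly_fun n"
  shows "(\<lambda>z. p z / g z ^ N) \<in> reg (affine_space n) (basic_open n g)"
  unfolding reg_affine_space_iff[OF openin_basic_open[OF g]]
proof
  fix x assume "x \<in> basic_open n g"
  then show "\<exists>r\<in>poly_fun n. \<exists>q\<in>poly_fun n. q x \<noteq> 0 \<and> basic_open n q \<subseteq> basic_open n g \<and>
      (\<forall>z\<in>basic_open n q. p z / g z ^ N = r z / q z)"
    by (intro bex2I[of "\<lambda>z. p z * g z" _ "\<lambda>z. g z ^ N * g z"] poly_fun.mult poly_fun_power p g) auto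
qed

section \<open>Frames and sections of vector bundles\<close>

text \<open>
  A local trivialization, unpacked as it is used: \<open>\<xi>\<close> gives the coordinates of a vector over \<open>U\<close> in the
  frame, and \<open>\<psi>\<close> the vector over a point of \<open>U\<close> with given coordinates.
\<close>

definition framing :: "'a fspace \<Rightarrow> ('e, 'a) vbundle \<Rightarrow> 'a set \<Rightarrow> nat \<Rightarrow>
    ('e \<Rightarrow> nat \<Rightarrow> complex) \<Rightarrow> ('a \<times> (nat \<Rightarrow> complex) \<Rightarrow> 'e) \<Rightarrow> bool" where
  "framing Y E U r \<xi> \<psi> \<longleftrightarrow> openin (zar Y) U \<and>
     morphism (restrict_fspace (total E) {e \<in> points (total E). proj E e \<in> U}) (affine_space r) \<xi> \<and>
     morphism (prod_fspace (restrict_fspace Y U) (affine_space r)) (total E) \<psi> \<and>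
     (\<forall>y\<in>U. \<forall>v\<in>affine_points r. \<psi> (y, v) \<in> fibre E y \<and> \<xi> (\<psi> (y, v)) = v) \<and>
     (\<forall>y\<in>U. \<forall>e\<in>fibre E y. \<psi> (y, \<xi> e) = e) \<and>
     (\<forall>y\<in>U. \<xi> (bzero E y) = 0) \<and>
     (\<forall>y\<in>U. \<forall>c. \<forall>e\<in>fibre E y. \<xi> (bscale E c e) = cscale c (\<xi> e))"

locale vector_bundle =
  fixes Y :: "'a fspace" and E :: "('e, 'a) vbundle"
  assumes Y: "space_with_functions Y" and E: "algebraic_vector_bundle Y E"
begin

lemma space_with_functions_total: "space_with_functions (total E)"
  using E by (simp add: algebraic_vector_bundle_def algebraic_variety_def)

lemma morphism_proj: "morphism (total E) Y (proj E)"
  using E by (simp add: algebraic_vector_bundle_def)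

lemma fibreD: "e \<in> fibre E y \<Longrightarrow> e \<in> points (total E)" "e \<in> fibre E y \<Longrightarrow> proj E e = y"
  by (simp_all add: fibre_def)

lemma in_fibre_proj: "e \<in> points (total E) \<Longrightarrow> e \<in> fibre E (proj E e)"
  by (simp add: fibre_def)

lemma bzero_in_fibre: "y \<in> points Y \<Longrightarrow> bzero E y \<in> fibre E y"
  and bscale_in_fibre: "e \<in> fibre E y \<Longrightarrow> bscale E c e \<in> fibre E y"
proof -
  show "y \<in> points Y \<Longrightarrow> bzero E y \<in> fibre E y"
    using E by (simp add: algebraic_vector_bundle_def)
  assume e: "e \<in> fibre E y"
  then have "y \<in> points Y" using morphism_points[OF morphism_proj, of e] by (auto dest: fibreD)
  then show "bscale E c e \<in> fibre E y"
    using E e by (simp add: algebraic_vector_bundle_def)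
qed

lemma openin_over: "openin (zar Y) U \<Longrightarrow> openin (zar (total E)) {e \<in> points (total E). proj E e \<in> U}"
  by (rule openin_morphism_preimage[OF morphism_proj])

lemma exists_framing:
  assumes y: "y \<in> points Y"
  obtains U r \<xi> \<psi> where "y \<in> U" "framing Y E U r \<xi> \<psi>"
proof -
  obtain U r \<phi> where U: "openin (zar Y) U" "y \<in> U" and triv: "local_trivialization Y E U r \<phi>"
    using E y unfolding algebraic_vector_bundle_def by blast
  let ?EU = "{e \<in> points (total E). proj E e \<in> U}"
  let ?P = "prod_fspace (restrict_fspace Y U) (affine_space r)"
  have \<phi>: "isomorphism (restrict_fspace (total E) ?EU) ?P \<phi>"
    and fst: "\<And>y e. y \<in> U \<Longrightarrow> e \<in> fibre E y \<Longrightarrow> fst (\<phi> e) = y"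
    and lin: "\<forall>y\<in>U. snd (\<phi> (bzero E y)) = 0"
      "\<forall>y\<in>U. \<forall>c. \<forall>e\<in>fibre E y. snd (\<phi> (bscale E c e)) = cscale c (snd (\<phi> e))"
    using triv unfolding local_trivialization_def by blast+
  obtain \<psi> where \<psi>: "morphism ?P (restrict_fspace (total E) ?EU) \<psi>"
    and inv: "\<And>e. e \<in> points (restrict_fspace (total E) ?EU) \<Longrightarrow> \<psi> (\<phi> e) = e"
      "\<And>w. w \<in> points ?P \<Longrightarrow> \<phi> (\<psi> w) = w"
    using \<phi> unfolding isomorphism_def by blast
  have \<phi>m: "morphism (restrict_fspace (total E) ?EU) ?P \<phi>" using \<phi> unfolding isomorphism_def by blast
  have YU: "space_with_functions (restrict_fspace Y U)" by (rule space_with_functions_restrict[OF Y U(1)])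
  have pP: "points ?P = U \<times> affine_points r"
    using topspace_prod_zariski[OF YU space_with_functions_affine_space] U(1)
    by (simp add: prod_fspace_def)
  have pE: "points (restrict_fspace (total E) ?EU) = ?EU"
    by (rule points_restrict_fspace[OF openin_over[OF U(1)]])
  have "framing Y E U r (\<lambda>e. snd (\<phi> e)) \<psi>"
    unfolding framing_def
  proof (intro conjI ballI allI)
    show "openin (zar Y) U" by fact
    show "morphism (restrict_fspace (total E) ?EU) (affine_space r) (\<lambda>e. snd (\<phi> e))"
      by (rule morphism_compose[OF \<phi>m morphism_snd[OF YU space_with_functions_affine_space]])
    show "morphism ?P (total E) \<psi>"
      by (rule morphism_extend_target[OF space_with_functions_total openin_over[OF U(1)] \<psi>])
  next
    fix y v assume yv: "y \<in> U" "v \<in> affine_points r"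
    then have w: "(y, v) \<in> points ?P" by (simp add: pP)
    then have e: "\<psi> (y, v) \<in> ?EU" using morphism_points[OF \<psi> w] by (simp only: pE)
    have "fst (\<phi> (\<psi> (y, v))) = proj E (\<psi> (y, v))"
      by (rule fst) (use e in \<open>auto simp: fibre_def\<close>)
    then show "\<psi> (y, v) \<in> fibre E y" using e inv(2)[OF w] by (simp add: fibre_def)
    show "snd (\<phi> (\<psi> (y, v))) = v" using inv(2)[OF w] by simp
  next
    fix y e assume ye: "y \<in> U" "e \<in> fibre E y"
    then have "(y, snd (\<phi> e)) = \<phi> e" using fst[OF ye] by (simp add: prod_eq_iff)
    moreover have "\<psi> (\<phi> e) = e" by (rule inv(1)) (use ye in \<open>simp only: pE, auto simp: fibre_def\<close>)
    ultimately show "\<psi> (y, snd (\<phi> e)) = e" by simp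
  qed (use lin in blast)+
  then show ?thesis using that U(2) by blast
qed

context
  fixes U r \<xi> \<psi>
  assumes F: "framing Y E U r \<xi> \<psi>"
begin

lemma framing_open: "openin (zar Y) U"
  using F by (simp add: framing_def)

lemma framing_points: "y \<in> U \<Longrightarrow> y \<in> points Y"
  using openin_subset[OF framing_open] by blast

lemma framing_inverse:
  assumes "y \<in> U"
  shows framing_in_fibre: "v \<in> affine_points r \<Longrightarrow> \<psi> (y, v) \<in> fibre E y"
    and framing_coords: "v \<in> affine_points r \<Longrightarrow> \<xi> (\<psi> (y, v)) = v"
    and framing_of_coords: "e \<in> fibre E y \<Longrightarrow> \<psi> (y, \<xi> e) = e"
    and framing_bzero: "\<xi> (bzero E y) = 0"
    and framing_bscale: "e \<in> fibre E y \<Longrightarrow> \<xi> (bscale E c e) = cscale c (\<xi> e)"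
  using F assms by (simp_all add: framing_def)

lemma framing_eqI: "y \<in> U \<Longrightarrow> e \<in> fibre E y \<Longrightarrow> e' \<in> fibre E y \<Longrightarrow> \<xi> e = \<xi> e' \<Longrightarrow> e = e'"
  using framing_of_coords by metis

lemma framing_coords_affine: "y \<in> U \<Longrightarrow> e \<in> fibre E y \<Longrightarrow> \<xi> e \<in> affine_points r"
  using morphism_points[of "restrict_fspace (total E) {e \<in> points (total E). proj E e \<in> U}" "affine_space r" \<xi> e]
    F by (auto simp: framing_def openin_over[OF framing_open] fibre_def)

lemma morphism_framing_coords:
  assumes S: "space_with_functions S" and m: "morphism S (total E) m"
    and mU: "\<And>x. x \<in> points S \<Longrightarrow> proj E (m x) \<in> U"
  shows "morphism S (affine_space r) (\<lambda>x. \<xi> (m x))"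
proof (rule morphism_compose[where f = m and g = \<xi>])
  show "morphism S (restrict_fspace (total E) {e \<in> points (total E). proj E e \<in> U}) m"
    by (rule morphism_restrict_target[OF openin_over[OF framing_open] m])
      (use mU morphism_points[OF m] in auto)
qed (use F in \<open>simp add: framing_def\<close>)

lemma morphism_of_framing_coords:
  assumes S: "space_with_functions S" and m: "morphism S Y m" and v: "morphism S (affine_space r) v"
    and mU: "\<And>x. x \<in> points S \<Longrightarrow> m x \<in> U"
  shows "morphism S (total E) (\<lambda>x. \<psi> (m x, v x))"
proof (rule morphism_compose[where f = "\<lambda>x. (m x, v x)" and g = \<psi>])
  show "morphism S (prod_fspace (restrict_fspace Y U) (affine_space r)) (\<lambda>x. (m x, v x))"
    by (intro morphism_pair S v space_with_functions_restrict Y framing_open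
        space_with_functions_affine_space morphism_restrict_target m mU)
  show "morphism (prod_fspace (restrict_fspace Y U) (affine_space r)) (total E) \<psi>"
    using F by (simp add: framing_def)
qed

end

lemma fibre_base: "e \<in> fibre E y \<Longrightarrow> y \<in> points Y"
  using morphism_points[OF morphism_proj, of e] by (auto dest: fibreD)

lemma bscale_zero: "e \<in> fibre E y \<Longrightarrow> bscale E 0 e = bzero E y"
proof -
  assume e: "e \<in> fibre E y"
  obtain U r \<xi> \<psi> where F: "y \<in> U" "framing Y E U r \<xi> \<psi>" using exists_framing[OF fibre_base[OF e]] .
  show ?thesis
    by (rule framing_eqI[OF F(2,1) bscale_in_fibre[OF e] bzero_in_fibre[OF fibre_base[OF e]]])
      (simp add: framing_bscale[OF F(2,1) e] framing_bzero[OF F(2,1)] cscale_def zero_fun_def)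
qed

lemma bscale_one: "e \<in> fibre E y \<Longrightarrow> bscale E 1 e = e"
proof -
  assume e: "e \<in> fibre E y"
  obtain U r \<xi> \<psi> where F: "y \<in> U" "framing Y E U r \<xi> \<psi>" using exists_framing[OF fibre_base[OF e]] .
  show ?thesis
    by (rule framing_eqI[OF F(2,1) bscale_in_fibre[OF e] e])
      (simp add: framing_bscale[OF F(2,1) e] cscale_def)
qed

text \<open>
  In a frame this multiplies the coordinate functions of \<open>m\<close> by the regular function \<open>u\<close>.
\<close>

lemma morphism_bscale:
  assumes S: "space_with_functions S" and m: "morphism S (total E) m" and u: "u \<in> reg S (points S)"
  shows "morphism S (total E) (\<lambda>x. bscale E (u x) (m x))"
proof (rule morphism_local[OF S])
  fix x assume x: "x \<in> points S"
  have pm: "morphism S Y (\<lambda>x. proj E (m x))" by (rule morphism_compose[OF m morphism_proj])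
  obtain U r \<xi> \<psi> where F: "proj E (m x) \<in> U" "framing Y E U r \<xi> \<psi>"
    using exists_framing[OF morphism_points[OF pm x]] .
  define V where "V = {x \<in> points S. proj E (m x) \<in> U}"
  have V: "openin (zar S) V"
    unfolding V_def by (rule openin_morphism_preimage[OF pm framing_open[OF F(2)]])
  note SV = space_with_functions_restrict[OF S V]
  have fib: "m x \<in> fibre E (proj E (m x))" if "x \<in> V" for x
    using that morphism_points[OF m] by (simp add: V_def in_fibre_proj)
  have mV: "morphism (restrict_fspace S V) (affine_space r) (\<lambda>x. \<xi> (m x))"
    by (rule morphism_framing_coords[OF F(2) SV morphism_restrict_source[OF S V m]])
      (use V in \<open>simp add: V_def\<close>)
  have "morphism (restrict_fspace S V) (affine_space r) (\<lambda>x. cscale (u x) (\<xi> (m x)))"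
  proof (rule morphism_into_affine_space[OF SV])
    fix x assume "x \<in> points (restrict_fspace S V)"
    from morphism_points[OF mV this]
    show "cscale (u x) (\<xi> (m x)) \<in> affine_points r" by (simp add: affine_points_def cscale_def)
  next
    fix i assume i: "i < r"
    have "u \<in> reg S V" by (rule reg_subset[OF S openin_topspace u V]) (auto simp: V_def)
    moreover have "(\<lambda>x. \<xi> (m x) i) \<in> reg S V" using morphism_affine_coord[OF mV i] V by simp
    ultimately show "(\<lambda>x. cscale (u x) (\<xi> (m x)) i) \<in> reg (restrict_fspace S V) (points (restrict_fspace S V))"
      using V by (simp add: cscale_def reg_mult[OF S V])
  qed
  then have "morphism (restrict_fspace S V) (total E) (\<lambda>x. \<psi> (proj E (m x), cscale (u x) (\<xi> (m x))))"
    by (intro morphism_of_framing_coords[OF F(2) SV] morphism_restrict_source[OF S V pm])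
      (use V in \<open>simp_all add: V_def\<close>)
  then have "morphism (restrict_fspace S V) (total E) (\<lambda>x. bscale E (u x) (m x))"
  proof (rule morphism_cong[OF SV])
    fix x assume "x \<in> points (restrict_fspace S V)"
    then have x: "x \<in> V" using V by simp
    then have U: "proj E (m x) \<in> U" by (simp add: V_def)
    show "bscale E (u x) (m x) = \<psi> (proj E (m x), cscale (u x) (\<xi> (m x)))"
      using framing_of_coords[OF F(2) U bscale_in_fibre[OF fib[OF x]], of "u x"]
        framing_bscale[OF F(2) U fib[OF x]] by simp
  qed
  moreover have "x \<in> V" using x F(1) by (simp add: V_def)
  ultimately show "\<exists>V. openin (zar S) V \<and> x \<in> V \<and> morphism (restrict_fspace S V) (total E) (\<lambda>x. bscale E (u x) (m x))"
    using V by blast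
qed

text \<open>
  Near the origin, on a set \<open>h \<noteq> 0\<close> with \<open>h 0 = 1\<close>, let \<open>\<sigma>\<^sub>0\<close> have the constant coordinates of \<open>e\<close> in some frame. Finitely many frames, over
  sets \<open>g \<noteq> 0\<close>, cover affine space. In each of them the coordinates of \<open>\<sigma>\<^sub>0\<close> are regular on \<open>h * g \<noteq> 0\<close>,
  hence become regular on \<open>g \<noteq> 0\<close> when multiplied by a large power of \<open>h\<close>. The resulting
  sections \<open>\<tau> g\<close> all extend \<open>h ^ N * \<sigma>\<^sub>0\<close>. They agree on overlaps, because they agree on the dense set
  \<open>h \<noteq> 0\<close>, and so they glue to a section whose value at the origin is \<open>h 0 ^ N * e = e\<close>.
\<close>

theorem exists_section_through:
  assumes f: "morphism (affine_space n) Y f" and e: "e \<in> fibre E (f 0)"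
  obtains \<sigma> where "morphism (affine_space n) (total E) \<sigma>"
    "\<And>z. z \<in> affine_points n \<Longrightarrow> proj E (\<sigma> z) = f z" "\<sigma> 0 = e"
proof -
  let ?A = "affine_space n"
  let ?A' = "\<lambda>g. restrict_fspace ?A (basic_open n g)"
  note A = space_with_functions_affine_space[of n]
  have A': "space_with_functions (?A' g)" "points (?A' g) = basic_open n g" if "g \<in> poly_fun n" for g
    using space_with_functions_restrict[OF A openin_basic_open[OF that]] openin_basic_open[OF that] by simp_all
  have zero: "0 \<in> affine_points n" by (simp add: affine_points_def)
  define chart where "chart g U r \<xi> \<psi> \<longleftrightarrow> framing Y E U r \<xi> \<psi> \<and> f ` basic_open n g \<subseteq> U"
    for g U r \<xi> \<psi>
  define G where "G = {g \<in> poly_fun n. \<exists>U r \<xi> \<psi>. chart g U r \<xi> \<psi>}"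
  have cover: "\<exists>g\<in>G. g z \<noteq> 0" if z: "z \<in> affine_points n" for z
  proof -
    have fz: "f z \<in> points Y" using morphism_points[OF f] z by simp
    obtain U r \<xi> \<psi> where F: "f z \<in> U" "framing Y E U r \<xi> \<psi>"
      using exists_framing[OF fz] .
    have "z \<in> {z \<in> points ?A. f z \<in> U}" using z F by simp
    from openin_affine_space_basic[OF openin_morphism_preimage[OF f framing_open[OF F(2)]] this]
    obtain g where g: "g \<in> poly_fun n" "g z \<noteq> 0" "basic_open n g \<subseteq> {z \<in> points ?A. f z \<in> U}" .
    then have "chart g U r \<xi> \<psi>" using F unfolding chart_def by blast
    then show ?thesis using g unfolding G_def by blast
  qed
  obtain K where K: "finite K" "K \<subseteq> G" "\<And>z. z \<in> affine_points n \<Longrightarrow> \<exists>g\<in>K. g z \<noteq> 0"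
    using finite_basic_open_subcover[of G n] cover unfolding G_def by blast
  have "\<forall>g. \<exists>U r \<xi> \<psi>. g \<in> K \<longrightarrow> chart g U r \<xi> \<psi>" using K(2) unfolding G_def by blast
  then obtain U r \<xi> \<psi> where chart: "\<And>g. g \<in> K \<Longrightarrow> chart g (U g) (r g) (\<xi> g) (\<psi> g)" by metis
  have Kp: "g \<in> poly_fun n" if "g \<in> K" for g using K(2) that unfolding G_def by blast
  have F: "framing Y E (U g) (r g) (\<xi> g) (\<psi> g)" if "g \<in> K" for g
    using chart[OF that] unfolding chart_def by blast
  have fU: "f z \<in> U g" if "g \<in> K" "z \<in> basic_open n g" for g z
    using chart[OF that(1)] that(2) unfolding chart_def by blast
  obtain h' where h': "h' \<in> G" "h' 0 \<noteq> 0" using cover[OF zero] by blast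
  define h where "h z = (1 / h' 0) * h' z" for z
  have h: "h \<in> poly_fun n" unfolding h_def using h'(1) by (intro poly_fun_cmult) (simp add: G_def)
  have h0: "h 0 = 1" using h'(2) by (simp add: h_def)
  have "basic_open n h = basic_open n h'" using h'(2) by (auto simp: h_def)
  then obtain U\<^sub>0 r\<^sub>0 \<xi>\<^sub>0 \<psi>\<^sub>0 where F0: "framing Y E U\<^sub>0 r\<^sub>0 \<xi>\<^sub>0 \<psi>\<^sub>0" and fU0: "\<And>z. z \<in> basic_open n h \<Longrightarrow> f z \<in> U\<^sub>0"
    using h'(1) unfolding G_def chart_def by blast
  define c where "c = \<xi>\<^sub>0 e"
  have f0: "f 0 \<in> U\<^sub>0" using fU0[of 0] zero h0 by simp
  have c: "c \<in> affine_points r\<^sub>0" unfolding c_def by (rule framing_coords_affine[OF F0 f0 e])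
  define \<sigma>\<^sub>0 where "\<sigma>\<^sub>0 z = \<psi>\<^sub>0 (f z, c)" for z
  have fr: "morphism (?A' g) Y f" if "g \<in> poly_fun n" for g
    by (rule morphism_restrict_source[OF A openin_basic_open[OF that] f])
  have \<sigma>0_fibre: "\<sigma>\<^sub>0 z \<in> fibre E (f z)" if "z \<in> basic_open n h" for z
    unfolding \<sigma>\<^sub>0_def by (rule framing_in_fibre[OF F0 fU0[OF that] c])
  have \<sigma>0: "morphism (?A' g) (total E) \<sigma>\<^sub>0" if "g \<in> poly_fun n" "basic_open n g \<subseteq> basic_open n h" for g
    unfolding \<sigma>\<^sub>0_def
  proof (rule morphism_of_framing_coords[OF F0 A'(1)[OF that(1)] fr[OF that(1)]])
    show "morphism (?A' g) (affine_space r\<^sub>0) (\<lambda>_. c)"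
      using c by (intro morphism_const A'(1)[OF that(1)]) simp
    fix z assume "z \<in> points (?A' g)"
    then have "z \<in> basic_open n g" by (simp only: A'(2)[OF that(1)])
    then show "f z \<in> U\<^sub>0" using that(2) fU0 by blast
  qed
  have "\<forall>\<^sub>F N in sequentially. \<forall>x\<in>Sigma K (\<lambda>g. {..<r g}). case x of (g, i) \<Rightarrow>
      \<exists>p\<in>poly_fun n. \<forall>z\<in>basic_open n (\<lambda>z. h z * g z). (h z * g z) ^ N * \<xi> g (\<sigma>\<^sub>0 z) i = p z"
  proof (rule eventually_ball_finite)
    show "finite (Sigma K (\<lambda>g. {..<r g}))" using K(1) by simp
    show "\<forall>x\<in>Sigma K (\<lambda>g. {..<r g}). \<forall>\<^sub>F N in sequentially. case x of (g, i) \<Rightarrow>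
      \<exists>p\<in>poly_fun n. \<forall>z\<in>basic_open n (\<lambda>z. h z * g z). (h z * g z) ^ N * \<xi> g (\<sigma>\<^sub>0 z) i = p z"
    proof (intro ballI, elim SigmaE, simp only: prod.case lessThan_iff)
      fix g i assume g: "g \<in> K" and i: "i < r g"
      have hg: "(\<lambda>z. h z * g z) \<in> poly_fun n" by (intro poly_fun.mult h Kp g)
      have "morphism (?A' (\<lambda>z. h z * g z)) (affine_space (r g)) (\<lambda>z. \<xi> g (\<sigma>\<^sub>0 z))"
      proof (rule morphism_framing_coords[OF F[OF g] A'(1)[OF hg]])
        show "morphism (?A' (\<lambda>z. h z * g z)) (total E) \<sigma>\<^sub>0" by (rule \<sigma>0[OF hg]) auto
        fix z assume "z \<in> points (?A' (\<lambda>z. h z * g z))"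
        then have z: "z \<in> basic_open n (\<lambda>z. h z * g z)" by (simp only: A'(2)[OF hg])
        then have "proj E (\<sigma>\<^sub>0 z) = f z" using fibreD(2)[OF \<sigma>0_fibre] by simp
        then show "proj E (\<sigma>\<^sub>0 z) \<in> U g" using fU[OF g] z by simp
      qed
      from morphism_affine_coord[OF this i]
      have "(\<lambda>z. \<xi> g (\<sigma>\<^sub>0 z) i) \<in> reg ?A (basic_open n (\<lambda>z. h z * g z))"
        by (simp only: reg_restrict_fspace A'(2)[OF hg])
      from regular_on_basic_open[OF hg this]
      show "\<forall>\<^sub>F N in sequentially. \<exists>p\<in>poly_fun n. \<forall>z\<in>basic_open n (\<lambda>z. h z * g z).
          (h z * g z) ^ N * \<xi> g (\<sigma>\<^sub>0 z) i = p z" .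
    qed
  qed
  from eventually_happens'[OF sequentially_bot this]
  obtain N where "\<forall>g\<in>K. \<forall>i<r g. \<exists>p. p \<in> poly_fun n \<and> (\<forall>z\<in>basic_open n (\<lambda>z. h z * g z).
      (h z * g z) ^ N * \<xi> g (\<sigma>\<^sub>0 z) i = p z)" by force
  then have "\<forall>g i. \<exists>p. g \<in> K \<longrightarrow> i < r g \<longrightarrow> p \<in> poly_fun n \<and>
      (\<forall>z\<in>basic_open n (\<lambda>z. h z * g z). (h z * g z) ^ N * \<xi> g (\<sigma>\<^sub>0 z) i = p z)" by blast
  then have "\<exists>p. \<forall>g i. g \<in> K \<longrightarrow> i < r g \<longrightarrow> p g i \<in> poly_fun n \<and>
      (\<forall>z\<in>basic_open n (\<lambda>z. h z * g z). (h z * g z) ^ N * \<xi> g (\<sigma>\<^sub>0 z) i = p g i z)"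
    unfolding choice_iff .
  then obtain p where p: "\<And>g i. g \<in> K \<Longrightarrow> i < r g \<Longrightarrow> p g i \<in> poly_fun n"
    and p_eq: "\<And>g i z. g \<in> K \<Longrightarrow> i < r g \<Longrightarrow> z \<in> basic_open n (\<lambda>z. h z * g z) \<Longrightarrow>
      (h z * g z) ^ N * \<xi> g (\<sigma>\<^sub>0 z) i = p g i z" by blast
  define v where "v g z = (\<lambda>i. if i < r g then p g i z / g z ^ N else 0)" for g z
  have vA: "v g z \<in> affine_points (r g)" for g z by (simp add: v_def affine_points_def)
  define \<tau> where "\<tau> g z = \<psi> g (f z, v g z)" for g z
  have \<tau>: "morphism (?A' g) (total E) (\<tau> g)" if g: "g \<in> K" for g
    unfolding \<tau>_def
  proof (rule morphism_of_framing_coords[OF F[OF g] A'(1)[OF Kp[OF g]] fr[OF Kp[OF g]]])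
    show "morphism (?A' g) (affine_space (r g)) (v g)"
    proof (rule morphism_into_affine_space[OF A'(1)[OF Kp[OF g]] vA])
      fix i assume "i < r g"
      then show "(\<lambda>z. v g z i) \<in> reg (?A' g) (points (?A' g))"
        unfolding A'(2)[OF Kp[OF g]] reg_restrict_fspace v_def
        using reg_poly_fun_over_power[OF p[OF g] Kp[OF g]] by simp
    qed
    fix z assume "z \<in> points (?A' g)"
    then show "f z \<in> U g" unfolding A'(2)[OF Kp[OF g]] by (rule fU[OF g])
  qed
  have \<tau>_fibre: "\<tau> g z \<in> fibre E (f z)" if "g \<in> K" "z \<in> basic_open n g" for g z
    unfolding \<tau>_def by (rule framing_in_fibre[OF F[OF that(1)] fU[OF that] vA])
  have \<tau>_eq: "\<tau> g z = bscale E (h z ^ N) (\<sigma>\<^sub>0 z)" if g: "g \<in> K" and z: "z \<in> basic_open n g" "h z \<noteq> 0" for g z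
  proof (rule framing_eqI[OF F[OF g] fU[OF g z(1)] \<tau>_fibre[OF g z(1)]])
    have s: "\<sigma>\<^sub>0 z \<in> fibre E (f z)" by (rule \<sigma>0_fibre) (use z in simp)
    then show "bscale E (h z ^ N) (\<sigma>\<^sub>0 z) \<in> fibre E (f z)" by (rule bscale_in_fibre)
    have coords: "\<xi> g (\<sigma>\<^sub>0 z) \<in> affine_points (r g)"
      by (rule framing_coords_affine[OF F[OF g] fU[OF g z(1)] s])
    have "v g z = cscale (h z ^ N) (\<xi> g (\<sigma>\<^sub>0 z))"
    proof
      fix i
      show "v g z i = cscale (h z ^ N) (\<xi> g (\<sigma>\<^sub>0 z)) i"
        using p_eq[OF g, of i z] z coords
        by (auto simp: v_def cscale_def affine_points_def power_mult_distrib field_simps)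
    qed
    then show "\<xi> g (\<tau> g z) = \<xi> g (bscale E (h z ^ N) (\<sigma>\<^sub>0 z))"
      unfolding \<tau>_def framing_coords[OF F[OF g] fU[OF g z(1)] vA]
        framing_bscale[OF F[OF g] fU[OF g z(1)] s] .
  qed
  have compat: "\<tau> g z = \<tau> g' z"
    if g: "g \<in> K" "g' \<in> K" and z: "z \<in> basic_open n g" "z \<in> basic_open n g'" for g g' z
  proof (rule framing_eqI[OF F[OF g(2)] fU[OF g(2) z(2)] \<tau>_fibre[OF g(1) z(1)] \<tau>_fibre[OF g(2) z(2)]])
    let ?gg = "\<lambda>z. g z * g' z"
    have gg: "?gg \<in> poly_fun n" by (intro poly_fun.mult Kp g)
    have m: "morphism (?A' ?gg) (affine_space (r g')) (\<lambda>z. \<xi> g' (\<tau> k z))" if k: "k \<in> K"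
      and sub: "basic_open n ?gg \<subseteq> basic_open n k" for k
    proof (rule morphism_framing_coords[OF F[OF g(2)] A'(1)[OF gg]])
      have "openin (zar (?A' k)) (basic_open n ?gg)"
        using sub openin_basic_open[OF Kp[OF k]] openin_basic_open[OF gg] by simp
      from morphism_restrict_source[OF A'(1)[OF Kp[OF k]] this \<tau>[OF k]]
      have "morphism (restrict_fspace (?A' k) (basic_open n ?gg)) (total E) (\<tau> k)" .
      moreover have "restrict_fspace (?A' k) (basic_open n ?gg) = ?A' ?gg"
        using sub by (simp add: restrict_fspace_def subtopology_subtopology Int_absorb1)
      ultimately show "morphism (?A' ?gg) (total E) (\<tau> k)" by simp
      fix z assume "z \<in> points (?A' ?gg)"
      then have z: "z \<in> basic_open n ?gg" unfolding A'(2)[OF gg] .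
      then have "proj E (\<tau> k z) = f z" using sub by (intro fibreD(2) \<tau>_fibre[OF k]) blast
      then show "proj E (\<tau> k z) \<in> U g'" using fU[OF g(2), of z] z by simp
    qed
    have m1: "morphism (?A' ?gg) (affine_space (r g')) (\<lambda>z. \<xi> g' (\<tau> g z))" by (rule m[OF g(1)]) auto
    have m2: "morphism (?A' ?gg) (affine_space (r g')) (\<lambda>z. \<xi> g' (\<tau> g' z))" by (rule m[OF g(2)]) auto
    show "\<xi> g' (\<tau> g z) = \<xi> g' (\<tau> g' z)"
    proof (rule morphism_into_affine_space_eq_of_eq_dense[OF gg h zero _ m1 m2])
      show "h 0 \<noteq> 0" using h0 by simp
      show "z \<in> basic_open n ?gg" using z by simp
      fix w assume "w \<in> basic_open n ?gg" "h w \<noteq> 0"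
      then show "\<xi> g' (\<tau> g w) = \<xi> g' (\<tau> g' w)" using \<tau>_eq[OF g(1), of w] \<tau>_eq[OF g(2), of w] by simp
    qed
  qed
  define \<sigma> where "\<sigma> z = \<tau> (SOME g. g \<in> K \<and> g z \<noteq> 0) z" for z
  have \<sigma>_eq: "\<sigma> z = \<tau> g z" if "g \<in> K" "z \<in> basic_open n g" for g z
  proof -
    let ?g = "SOME g. g \<in> K \<and> g z \<noteq> 0"
    have "?g \<in> K \<and> ?g z \<noteq> 0"
      by (rule someI[of "\<lambda>g. g \<in> K \<and> g z \<noteq> 0" g]) (use that in simp)
    then have "\<tau> ?g z = \<tau> g z" by (intro compat) (use that in simp_all)
    then show ?thesis by (simp only: \<sigma>_def)
  qed
  show ?thesis
  proof (rule that)
    show "morphism ?A (total E) \<sigma>"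
    proof (rule morphism_local[OF A])
      fix z assume z: "z \<in> points ?A"
      then obtain g where g: "g \<in> K" "g z \<noteq> 0" using K(3) by auto
      have "morphism (?A' g) (total E) \<sigma>"
        by (rule morphism_cong[OF A'(1)[OF Kp[OF g(1)]] \<tau>[OF g(1)]])
          (use \<sigma>_eq[OF g(1)] in \<open>simp only: A'(2)[OF Kp[OF g(1)]]\<close>)
      then show "\<exists>V. openin (zar ?A) V \<and> z \<in> V \<and> morphism (restrict_fspace ?A V) (total E) \<sigma>"
        using z g openin_basic_open[OF Kp[OF g(1)]] by (intro exI[of _ "basic_open n g"]) simp
    qed
    show "proj E (\<sigma> z) = f z" if z: "z \<in> affine_points n" for z
    proof -
      obtain g where g: "g \<in> K" "g z \<noteq> 0" using K(3)[OF z] by blast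
      then show ?thesis using \<sigma>_eq[OF g(1), of z] \<tau>_fibre[OF g(1), of z] z by (simp add: fibreD)
    qed
    obtain g where g: "g \<in> K" "g 0 \<noteq> 0" using K(3)[OF zero] by blast
    have s0: "\<sigma>\<^sub>0 0 = e" unfolding \<sigma>\<^sub>0_def c_def by (rule framing_of_coords[OF F0 f0 e])
    have "\<sigma> 0 = bscale E (h 0 ^ N) (\<sigma>\<^sub>0 0)"
      using \<sigma>_eq[OF g(1), of 0] \<tau>_eq[OF g(1), of 0] g(2) zero h0 by simp
    then show "\<sigma> 0 = e" using bscale_one[OF e] by (simp add: h0 s0)
  qed
qed

end

section \<open>Tangent vectors\<close>

lemma tangent_spaceD:
  assumes "D \<in> tangent_space X x"
  shows tangent_not_regular: "f \<notin> regular_at X x \<Longrightarrow> D f = 0"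
    and tangent_cong: "openin (zar X) U \<Longrightarrow> x \<in> U \<Longrightarrow> f \<in> reg X U \<Longrightarrow> (\<And>z. z \<in> U \<Longrightarrow> f z = g z) \<Longrightarrow> D f = D g"
    and tangent_scale: "f \<in> regular_at X x \<Longrightarrow> D (cscale c f) = c * D f"
    and tangent_add: "f \<in> regular_at X x \<Longrightarrow> g \<in> regular_at X x \<Longrightarrow> D (\<lambda>z. f z + g z) = D f + D g"
    and tangent_mult: "f \<in> regular_at X x \<Longrightarrow> g \<in> regular_at X x \<Longrightarrow>
      D (\<lambda>z. f z * g z) = f x * D g + g x * D f"
  using assms unfolding tangent_space_def plus_fun_def times_fun_def by blast+

lemma tangent_spaceI:
  assumes "\<And>f. f \<notin> regular_at X x \<Longrightarrow> D f = 0"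
    and "\<And>U f g. openin (zar X) U \<Longrightarrow> x \<in> U \<Longrightarrow> f \<in> reg X U \<Longrightarrow> (\<And>z. z \<in> U \<Longrightarrow> f z = g z) \<Longrightarrow> D f = D g"
    and "\<And>c f. f \<in> regular_at X x \<Longrightarrow> D (cscale c f) = c * D f"
    and "\<And>f g. f \<in> regular_at X x \<Longrightarrow> g \<in> regular_at X x \<Longrightarrow> D (\<lambda>z. f z + g z) = D f + D g"
    and "\<And>f g. f \<in> regular_at X x \<Longrightarrow> g \<in> regular_at X x \<Longrightarrow>
      D (\<lambda>z. f z * g z) = f x * D g + g x * D f"
  shows "D \<in> tangent_space X x"
  unfolding tangent_space_def plus_fun_def times_fun_def
proof (intro CollectI conjI allI ballI impI)
  fix U f g assume "openin (zar X) U" "x \<in> U" "f \<in> reg X U" "\<forall>z\<in>U. f z = g z"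
  then show "D f = D g" using assms(2) by blast
qed (rule assms; assumption)+

lemma regular_atI: "openin (zar X) U \<Longrightarrow> x \<in> U \<Longrightarrow> f \<in> reg X U \<Longrightarrow> f \<in> regular_at X x"
  unfolding regular_at_def by blast

lemma regular_at_common:
  assumes X: "space_with_functions X" and "f \<in> regular_at X x" "g \<in> regular_at X x"
  obtains U where "openin (zar X) U" "x \<in> U" "f \<in> reg X U" "g \<in> reg X U"
proof -
  obtain U V where UV: "openin (zar X) U" "x \<in> U" "f \<in> reg X U" "openin (zar X) V" "x \<in> V" "g \<in> reg X V"
    using assms unfolding regular_at_def by blast
  show ?thesis
  proof (rule that[of "U \<inter> V"])
    show o: "openin (zar X) (U \<inter> V)" using UV by (simp add: openin_Int)
    show "f \<in> reg X (U \<inter> V)" by (rule reg_subset[OF X UV(1,3) o]) simp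
    show "g \<in> reg X (U \<inter> V)" by (rule reg_subset[OF X UV(4,6) o]) simp
  qed (use UV in simp)
qed

lemma
  assumes X: "space_with_functions X"
  shows regular_at_const: "x \<in> points X \<Longrightarrow> (\<lambda>_. c) \<in> regular_at X x"
    and regular_at_add: "f \<in> regular_at X x \<Longrightarrow> g \<in> regular_at X x \<Longrightarrow> (\<lambda>z. f z + g z) \<in> regular_at X x"
    and regular_at_mult: "f \<in> regular_at X x \<Longrightarrow> g \<in> regular_at X x \<Longrightarrow> (\<lambda>z. f z * g z) \<in> regular_at X x"
    and regular_at_scale: "f \<in> regular_at X x \<Longrightarrow> cscale c f \<in> regular_at X x"
proof -
  show "x \<in> points X \<Longrightarrow> (\<lambda>_. c) \<in> regular_at X x"
    by (rule regular_atI[OF openin_topspace _ reg_const[OF X openin_topspace]])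
  assume f: "f \<in> regular_at X x"
  then obtain U where U: "openin (zar X) U" "x \<in> U" "f \<in> reg X U" unfolding regular_at_def by blast
  have "(\<lambda>z. c * f z) \<in> reg X U"
    by (rule reg_mult[OF X U(1) reg_const[OF X U(1)] U(3)])
  then show "cscale c f \<in> regular_at X x" unfolding cscale_def by (rule regular_atI[OF U(1,2)])
  assume g: "g \<in> regular_at X x"
  obtain U where U: "openin (zar X) U" "x \<in> U" "f \<in> reg X U" "g \<in> reg X U"
    using regular_at_common[OF X f g] .
  show "(\<lambda>z. f z + g z) \<in> regular_at X x" "(\<lambda>z. f z * g z) \<in> regular_at X x"
    by (rule regular_atI[OF U(1,2)], rule reg_add[OF X U(1,3,4)])
      (rule regular_atI[OF U(1,2)], rule reg_mult[OF X U(1,3,4)])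
qed

lemma tangent_const:
  assumes X: "space_with_functions X" and x: "x \<in> points X" and D: "D \<in> tangent_space X x"
  shows "D (\<lambda>_. c) = 0"
proof -
  note r = regular_at_const[OF X x]
  have "D (\<lambda>_. 1) = 0" using tangent_mult[OF D r[of 1] r[of 1]] by simp
  then show ?thesis using tangent_scale[OF D r[of 1], of c] by (simp add: cscale_def)
qed

lemma subspace_tangent_space: "cfun.subspace (tangent_space X x)"
proof (rule cfun.subspaceI)
  show "0 \<in> tangent_space X x" by (simp add: tangent_space_def)
  fix D assume D: "D \<in> tangent_space X x"
  note d = tangent_not_regular[OF D] tangent_scale[OF D] tangent_add[OF D] tangent_mult[OF D]
  show "cscale c D \<in> tangent_space X x" for c
    unfolding cscale_def[of c D]
  proof (rule tangent_spaceI)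
    fix U f g assume "openin (zar X) U" "x \<in> U" "f \<in> reg X U" "\<And>z. z \<in> U \<Longrightarrow> f z = g z"
    from tangent_cong[OF D this] show "c * D f = c * D g" by simp
  qed (simp_all add: d algebra_simps)
  fix D' assume D': "D' \<in> tangent_space X x"
  note d' = tangent_not_regular[OF D'] tangent_scale[OF D'] tangent_add[OF D'] tangent_mult[OF D']
  show "D + D' \<in> tangent_space X x"
    unfolding plus_fun_def
  proof (rule tangent_spaceI)
    fix U f g assume "openin (zar X) U" "x \<in> U" "f \<in> reg X U" "\<And>z. z \<in> U \<Longrightarrow> f z = g z"
    from tangent_cong[OF D this] tangent_cong[OF D' this] show "D f + D' f = D g + D' g" by simp
  qed (simp_all add: d d' algebra_simps)
qed

lemma regular_at_restrict:
  assumes X: "space_with_functions X" and U: "openin (zar X) U" "x \<in> U"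
  shows "regular_at (restrict_fspace X U) x = regular_at X x"
proof
  show "regular_at (restrict_fspace X U) x \<subseteq> regular_at X x"
    unfolding regular_at_def using U by auto
  show "regular_at X x \<subseteq> regular_at (restrict_fspace X U) x"
  proof
    fix f assume "f \<in> regular_at X x"
    then obtain V where V: "openin (zar X) V" "x \<in> V" "f \<in> reg X V" unfolding regular_at_def by blast
    have o: "openin (zar X) (U \<inter> V)" using U V by (simp add: openin_Int)
    show "f \<in> regular_at (restrict_fspace X U) x"
      by (rule regular_atI[of _ "U \<inter> V"]) (use U V o reg_subset[OF X V(1,3) o] in simp_all)
  qed
qed

lemma tangent_space_restrict:
  assumes X: "space_with_functions X" and U: "openin (zar X) U" "x \<in> U"
    and D: "D \<in> tangent_space X x"
  shows "D \<in> tangent_space (restrict_fspace X U) x"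
  using D U unfolding tangent_space_def regular_at_restrict[OF X U] by auto

lemma regular_at_pullback:
  assumes f: "morphism X Y f" and x: "x \<in> points X" and g: "g \<in> regular_at Y (f x)"
  shows "(\<lambda>z. g (f z)) \<in> regular_at X x"
proof -
  obtain V where V: "openin (zar Y) V" "f x \<in> V" "g \<in> reg Y V" using g unfolding regular_at_def by blast
  show ?thesis
    by (rule regular_atI[OF openin_morphism_preimage[OF f V(1)] _ reg_morphism_pullback[OF f V(1,3)]])
      (use x V in simp)
qed

lemma differential_tangent:
  assumes Y: "space_with_functions Y" and f: "morphism X Y f" and x: "x \<in> points X"
    and D: "D \<in> tangent_space X x"
  shows "differential Y f x D \<in> tangent_space Y (f x)"
proof -
  note r = regular_at_pullback[OF f x]
  have cong: "differential Y f x D g = differential Y f x D h"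
    if V: "openin (zar Y) V" "f x \<in> V" "g \<in> reg Y V" "\<And>z. z \<in> V \<Longrightarrow> g z = h z" for V g h
  proof -
    have "h \<in> reg Y V" by (rule reg_cong[OF Y V(1,3)]) (use V in simp)
    then have "g \<in> regular_at Y (f x)" "h \<in> regular_at Y (f x)" using V by (auto intro: regular_atI)
    moreover have "D (\<lambda>z. g (f z)) = D (\<lambda>z. h (f z))"
      by (rule tangent_cong[OF D openin_morphism_preimage[OF f V(1)] _ reg_morphism_pullback[OF f V(1,3)]])
        (use V x in auto)
    ultimately show ?thesis by (simp add: differential_def comp_def)
  qed
  show ?thesis
  proof (rule tangent_spaceI)
    fix g assume "g \<notin> regular_at Y (f x)"
    then show "differential Y f x D g = 0" by (simp add: differential_def)
  next
    fix V g h assume "openin (zar Y) V" "f x \<in> V" "g \<in> reg Y V" "\<And>z. z \<in> V \<Longrightarrow> g z = h z"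
    then show "differential Y f x D g = differential Y f x D h" by (rule cong)
  next
    fix c g assume g: "g \<in> regular_at Y (f x)"
    show "differential Y f x D (cscale c g) = c * differential Y f x D g"
      using tangent_scale[OF D r[OF g], of c] g regular_at_scale[OF Y g, of c]
      by (simp add: differential_def comp_def cscale_def)
  next
    fix g h assume g: "g \<in> regular_at Y (f x)" and h: "h \<in> regular_at Y (f x)"
    show "differential Y f x D (\<lambda>z. g z + h z) = differential Y f x D g + differential Y f x D h"
      using tangent_add[OF D r[OF g] r[OF h]] g h regular_at_add[OF Y g h]
      by (simp add: differential_def comp_def)
    show "differential Y f x D (\<lambda>z. g z * h z) = g (f x) * differential Y f x D h + h (f x) * differential Y f x D g"
      using tangent_mult[OF D r[OF g] r[OF h]] g h regular_at_mult[OF Y g h]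
      by (simp add: differential_def comp_def)
  qed
qed

lemma differential_compose:
  assumes g: "morphism Y Z g" and y: "f x \<in> points Y"
  shows "differential Z g (f x) (differential Y f x D) = differential Z (\<lambda>w. g (f w)) x D"
  using regular_at_pullback[OF g y] by (auto simp: differential_def comp_def fun_eq_iff)

lemma sum_fun_apply: "(\<Sum>i\<in>I. F i) x = (\<Sum>i\<in>I. F i x :: complex)"
  by (induction I rule: infinite_finite_induct) auto

lemma differential_sum:
  "differential Y f x (\<Sum>i\<in>I. cscale (a i) (F i)) = (\<Sum>i\<in>I. cscale (a i) (differential Y f x (F i)))"
  by (auto simp: differential_def fun_eq_iff sum_fun_apply cscale_def)

section \<open>The tangent space of affine space at the origin\<close>

definition unit_vec :: "nat \<Rightarrow> nat \<Rightarrow> complex" where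
  "unit_vec i = (\<lambda>j. if j = i then 1 else 0)"

lemma unit_vec_affine: "i < n \<Longrightarrow> cscale t (unit_vec i) \<in> affine_points n"
  by (auto simp: unit_vec_def affine_points_def cscale_def)

lemma zero_affine: "0 \<in> affine_points n"
  by (simp add: affine_points_def)

text \<open>
  The velocity of the curve \<open>\<gamma>\<close> at time \<open>0\<close> as a derivation. The derivative is the complex analytic one,
  which exists for the curves used here because they are algebraic.
\<close>

definition velocity :: "'a fspace \<Rightarrow> 'a \<Rightarrow> (complex \<Rightarrow> 'a) \<Rightarrow> ('a \<Rightarrow> complex) \<Rightarrow> complex" where
  "velocity X x \<gamma> = (\<lambda>g. if g \<in> regular_at X x then deriv (\<lambda>t. g (\<gamma> t)) 0 else 0)"

lemma coord_regular_at: "i < n \<Longrightarrow> (\<lambda>z. z i) \<in> regular_at (affine_space n) 0"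
  by (intro regular_atI[OF openin_topspace] poly_fun_reg_affine_space openin_topspace poly_fun.coord)
    (simp add: zero_affine)

lemma poly_fun_on_ray: "p \<in> poly_fun n \<Longrightarrow> \<exists>P :: complex poly. \<forall>t. p (cscale t c) = poly P t"
  using poly_fun_on_line[of p n "\<lambda>_. 0" c] by (simp add: cscale_def)

text \<open>
  Here the Zariski topology on affine space meets the Euclidean topology on the parameter \<open>t\<close>: a
  polynomial that does not vanish at the origin does not vanish at nearby points of the ray.
\<close>

lemma eventually_ray_in_open:
  assumes c: "c \<in> affine_points n" and U: "openin (zar (affine_space n)) U" "0 \<in> U"
  shows "\<forall>\<^sub>F t in nhds 0. cscale t c \<in> U"
proof -
  obtain q where q: "q \<in> poly_fun n" "q 0 \<noteq> 0" "basic_open n q \<subseteq> U"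
    using openin_affine_space_basic[OF U] .
  obtain Q where Q: "\<And>t. q (cscale t c) = poly Q t" using poly_fun_on_ray[OF q(1)] by blast
  have "poly Q 0 \<noteq> 0" using Q[of 0] q(2) by (simp add: cscale_def zero_fun_def)
  moreover have "open {t. poly Q t \<noteq> 0}" by (intro open_Collect_neq continuous_intros)
  ultimately have "\<forall>\<^sub>F t in nhds 0. poly Q t \<noteq> 0"
    using eventually_nhds_in_open[of "{t. poly Q t \<noteq> 0}" 0] by simp
  then show ?thesis
  proof eventually_elim
    case (elim t)
    then have "cscale t c \<in> basic_open n q" using c Q by (simp add: affine_points_def cscale_def)
    then show ?case using q(3) by blast
  qed
qed

lemma regular_has_derivative_on_ray:
  assumes c: "c \<in> affine_points n" and g: "g \<in> regular_at (affine_space n) 0"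
  shows "((\<lambda>t. g (cscale t c)) has_field_derivative deriv (\<lambda>t. g (cscale t c)) 0) (at 0)"
proof -
  obtain U where U: "openin (zar (affine_space n)) U" "0 \<in> U" "g \<in> reg (affine_space n) U"
    using g unfolding regular_at_def by blast
  obtain p q where p: "p \<in> poly_fun n" "q \<in> poly_fun n" "q 0 \<noteq> 0" "basic_open n q \<subseteq> U"
    "\<forall>z\<in>basic_open n q. g z = p z / q z" using reg_affine_space_fraction[OF U(1,3,2)] .
  obtain P where P: "\<And>t. p (cscale t c) = poly P t" using poly_fun_on_ray[OF p(1)] by blast
  obtain Q where Q: "\<And>t. q (cscale t c) = poly Q t" using poly_fun_on_ray[OF p(2)] by blast
  have Q0: "poly Q 0 \<noteq> 0" using Q[of 0] p(3) by (simp add: cscale_def zero_fun_def)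
  have "0 \<in> basic_open n q" using p(3) by (simp add: zero_affine)
  from eventually_ray_in_open[OF c openin_basic_open[OF p(2)] this]
  have ev: "\<forall>\<^sub>F t in nhds 0. g (cscale t c) = poly P t / poly Q t"
  proof eventually_elim
    case (elim t)
    from bspec[OF p(5) this] show ?case by (simp only: P Q)
  qed
  obtain d where "((\<lambda>t. poly P t / poly Q t) has_field_derivative d) (at 0)"
    using DERIV_divide[OF poly_DERIV poly_DERIV Q0] by blast
  then have "((\<lambda>t. g (cscale t c)) has_field_derivative d) (at 0)"
    using DERIV_cong_ev[OF refl ev refl] by blast
  then show ?thesis using DERIV_imp_deriv by metis
qed

lemma velocity_ray_tangent:
  assumes c: "c \<in> affine_points n"
  shows "velocity (affine_space n) 0 (\<lambda>t. cscale t c) \<in> tangent_space (affine_space n) 0"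
proof -
  let ?A = "affine_space n"
  note A = space_with_functions_affine_space[of n]
  note d = regular_has_derivative_on_ray[OF c]
  have z: "cscale 0 c = 0" by (simp add: cscale_def zero_fun_def)
  show ?thesis
  proof (rule tangent_spaceI)
    fix g assume "g \<notin> regular_at ?A 0"
    then show "velocity ?A 0 (\<lambda>t. cscale t c) g = 0" by (simp add: velocity_def)
  next
    fix U g h assume U: "openin (zar ?A) U" "0 \<in> U" "g \<in> reg ?A U" "\<And>z. z \<in> U \<Longrightarrow> g z = h z"
    have "h \<in> reg ?A U" by (rule reg_cong[OF A U(1,3)]) (use U in simp)
    then have "g \<in> regular_at ?A 0" "h \<in> regular_at ?A 0" using U by (auto intro: regular_atI)
    moreover have "\<forall>\<^sub>F t in nhds 0. g (cscale t c) = h (cscale t c)"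
      using eventually_ray_in_open[OF c U(1,2)] by eventually_elim (use U in blast)
    ultimately show "velocity ?A 0 (\<lambda>t. cscale t c) g = velocity ?A 0 (\<lambda>t. cscale t c) h"
      by (simp add: velocity_def deriv_cong_ev)
  next
    fix b g assume g: "g \<in> regular_at ?A 0"
    have "deriv (\<lambda>t. b * g (cscale t c)) 0 = b * deriv (\<lambda>t. g (cscale t c)) 0"
      by (rule DERIV_imp_deriv, rule DERIV_cmult, rule d[OF g])
    then show "velocity ?A 0 (\<lambda>t. cscale t c) (cscale b g) = b * velocity ?A 0 (\<lambda>t. cscale t c) g"
      using g regular_at_scale[OF A g, of b] by (simp add: velocity_def cscale_def[of b])
  next
    fix g h assume g: "g \<in> regular_at ?A 0" and h: "h \<in> regular_at ?A 0"
    have "deriv (\<lambda>t. g (cscale t c) + h (cscale t c)) 0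
        = deriv (\<lambda>t. g (cscale t c)) 0 + deriv (\<lambda>t. h (cscale t c)) 0"
      by (rule DERIV_imp_deriv, rule DERIV_add; rule d; fact)
    then show "velocity ?A 0 (\<lambda>t. cscale t c) (\<lambda>z. g z + h z)
        = velocity ?A 0 (\<lambda>t. cscale t c) g + velocity ?A 0 (\<lambda>t. cscale t c) h"
      using g h regular_at_add[OF A g h] by (simp add: velocity_def)
    have "deriv (\<lambda>t. g (cscale t c) * h (cscale t c)) 0
        = deriv (\<lambda>t. g (cscale t c)) 0 * h (cscale 0 c) + deriv (\<lambda>t. h (cscale t c)) 0 * g (cscale 0 c)"
      by (rule DERIV_imp_deriv, rule DERIV_mult; rule d; fact)
    then show "velocity ?A 0 (\<lambda>t. cscale t c) (\<lambda>z. g z * h z)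
        = g 0 * velocity ?A 0 (\<lambda>t. cscale t c) h + h 0 * velocity ?A 0 (\<lambda>t. cscale t c) g"
      using g h regular_at_mult[OF A g h] by (simp add: velocity_def z)
  qed
qed

lemma velocity_ray_coord:
  assumes "j < n"
  shows "velocity (affine_space n) 0 (\<lambda>t. cscale t c) (\<lambda>z. z j) = c j"
proof -
  have "((\<lambda>t. t * c j) has_field_derivative c j) (at 0)"
    by (auto intro!: derivative_eq_intros)
  then have "deriv (\<lambda>t. cscale t c j) 0 = c j" unfolding cscale_def by (rule DERIV_imp_deriv)
  then show ?thesis using coord_regular_at[OF assms] by (simp add: velocity_def)
qed

text \<open>
  By the product rule the coordinates determine a derivation on polynomials, hence on fractions.
\<close>

lemma tangent_affine_space_eqI:
  assumes D: "D \<in> tangent_space (affine_space n) 0" and D': "D' \<in> tangent_space (affine_space n) 0"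
    and eq: "\<And>i. i < n \<Longrightarrow> D (\<lambda>z. z i) = D' (\<lambda>z. z i)"
  shows "D = D'"
proof
  note A = space_with_functions_affine_space[of n]
  have 0: "0 \<in> points (affine_space n)" by (simp add: zero_affine)
  have pr: "p \<in> regular_at (affine_space n) 0" if "p \<in> poly_fun n" for p
    by (rule regular_atI[OF openin_topspace 0 poly_fun_reg_affine_space[OF openin_topspace that]])
  have poly: "D p = D' p" if "p \<in> poly_fun n" for p
    using that
  proof induction
    case (const c) then show ?case by (simp add: tangent_const[OF A 0 D] tangent_const[OF A 0 D'])
  next
    case (coord i) then show ?case by (rule eq)
  next
    case (add p q)
    then show ?case by (simp add: tangent_add[OF D pr pr] tangent_add[OF D' pr pr])
  next
    case (mult p q)
    then show ?case by (simp add: tangent_mult[OF D pr pr] tangent_mult[OF D' pr pr])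
  qed
  fix f
  show "D f = D' f"
  proof (cases "f \<in> regular_at (affine_space n) 0")
    case False
    then show ?thesis by (simp add: tangent_not_regular[OF D] tangent_not_regular[OF D'])
  next
    case True
    then obtain U where U: "openin (zar (affine_space n)) U" "0 \<in> U" "f \<in> reg (affine_space n) U"
      unfolding regular_at_def by blast
    obtain p q where p: "p \<in> poly_fun n" "q \<in> poly_fun n" "q 0 \<noteq> 0" "basic_open n q \<subseteq> U"
      "\<forall>z\<in>basic_open n q. f z = p z / q z" using reg_affine_space_fraction[OF U(1,3,2)] .
    have quot: "d p = f 0 * d q + q 0 * d f" if d: "d \<in> tangent_space (affine_space n) 0" for d
    proof -
      have "d p = d (\<lambda>z. f z * q z)"
        by (rule tangent_cong[OF d openin_basic_open[OF p(2)] _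
              poly_fun_reg_affine_space[OF openin_basic_open[OF p(2)] p(1)]])
          (use p zero_affine in auto)
      then show ?thesis using tangent_mult[OF d True pr[OF p(2)]] by simp
    qed
    have "q 0 * D f = q 0 * D' f"
      using quot[OF D] quot[OF D'] poly[OF p(1)] poly[OF p(2)] by (metis add_left_cancel)
    then show ?thesis using p(3) by simp
  qed
qed

lemma tangent_affine_space_expansion:
  assumes D: "D \<in> tangent_space (affine_space n) 0"
  shows "D = (\<Sum>i<n. cscale (D (\<lambda>z. z i)) (velocity (affine_space n) 0 (\<lambda>t. cscale t (unit_vec i))))"
    (is "D = ?S")
proof (rule tangent_affine_space_eqI[OF D])
  show "?S \<in> tangent_space (affine_space n) 0"
  proof (intro cfun.subspace_sum[OF subspace_tangent_space] cfun.subspace_scale[OF subspace_tangent_space]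
      velocity_ray_tangent)
    fix i assume "i \<in> {..<n}"
    then show "unit_vec i \<in> affine_points n" by (auto simp: unit_vec_def affine_points_def)
  qed
  fix j assume j: "j < n"
  have "?S (\<lambda>z. z j) = (\<Sum>i<n. if j = i then D (\<lambda>z. z i) else 0)"
    unfolding sum_fun_apply
    by (rule sum.cong) (simp_all add: cscale_def[of "D _"] velocity_ray_coord[OF j] unit_vec_def)
  also have "\<dots> = D (\<lambda>z. z j)" using j by simp
  finally show "D (\<lambda>z. z j) = ?S (\<lambda>z. z j)" by simp
qed

lemma differential_velocity:
  assumes f: "morphism X Y f" and x: "\<gamma> 0 = x" "x \<in> points X"
  shows "differential Y f x (velocity X x \<gamma>) = velocity Y (f x) (\<lambda>t. f (\<gamma> t))"
  using regular_at_pullback[OF f x(2)] by (auto simp: differential_def velocity_def comp_def fun_eq_iff)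

section \<open>Sprays\<close>

context vector_bundle
begin

lemma framing_fibre_morphism:
  assumes F: "framing Y E U r \<xi> \<psi>" and y: "y \<in> U"
  shows "morphism (affine_space r) (total E) (\<lambda>v. \<psi> (y, v))"
proof (rule morphism_of_framing_coords[OF F space_with_functions_affine_space])
  show "morphism (affine_space r) Y (\<lambda>_. y)"
    by (rule morphism_const[OF space_with_functions_affine_space framing_points[OF F y]])
  show "morphism (affine_space r) (affine_space r) (\<lambda>v. v)"
    by (rule morphism_id)
qed (rule y)

text \<open>
  In a frame the composition \<open>e \<mapsto> \<psi> (y, \<xi> e)\<close> is a retraction onto the fibre. A germ and its
  composition with the retraction have a difference that vanishes on the fibre, so \<open>D\<close> kills it; hence
  \<open>D\<close> is the image of its push-forward under \<open>\<xi>\<close>.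
\<close>

lemma tangent_to_fibre_from_affine_space:
  assumes y: "y \<in> U" and F: "framing Y E U r \<xi> \<psi>"
    and D: "D \<in> tangent_to (total E) (fibre E y) (bzero E y)"
  obtains D' where "D' \<in> tangent_space (affine_space r) 0"
    "D = differential (total E) (\<lambda>v. \<psi> (y, v)) 0 D'"
proof -
  let ?e = "bzero E y" and ?EU = "restrict_fspace (total E) {e \<in> points (total E). proj E e \<in> U}"
  have yY: "y \<in> points Y" by (rule framing_points[OF F y])
  note e = bzero_in_fibre[OF yY]
  note EUo = openin_over[OF framing_open[OF F]]
  have eEU: "?e \<in> {e \<in> points (total E). proj E e \<in> U}" using e y by (simp add: fibre_def)
  have pEU: "points ?EU = {e \<in> points (total E). proj E e \<in> U}" by (rule points_restrict_fspace[OF EUo])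
  have EUs: "space_with_functions ?EU" by (rule space_with_functions_restrict[OF space_with_functions_total EUo])
  note A = space_with_functions_affine_space
  define \<iota> where "\<iota> v = \<psi> (y, v)" for v
  have \<iota>: "morphism (affine_space r) (total E) \<iota>"
    unfolding \<iota>_def
    by (rule framing_fibre_morphism[OF F y])
  have \<xi>: "morphism ?EU (affine_space r) \<xi>" using F by (simp add: framing_def)
  have \<xi>e: "\<xi> ?e = 0" by (rule framing_bzero[OF F y])
  have \<iota>0: "\<iota> 0 = ?e" using framing_of_coords[OF F y e] \<xi>e by (simp add: \<iota>_def)
  have DT: "D \<in> tangent_space (total E) ?e" using D by (simp add: tangent_to_def)
  define D' where "D' = differential (affine_space r) \<xi> ?e D"
  have D': "D' \<in> tangent_space (affine_space r) 0"
    using differential_tangent[OF A \<xi> _ tangent_space_restrict[OF space_with_functions_total EUo eEU DT]] eEU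
    unfolding pEU \<xi>e D'_def by blast
  have "D = differential (total E) \<iota> 0 D'"
  proof
    fix h
    show "D h = differential (total E) \<iota> 0 D' h"
    proof (cases "h \<in> regular_at (total E) ?e")
      case False
      then show ?thesis using tangent_not_regular[OF DT False] by (simp add: differential_def \<iota>0)
    next
      case True
      have "(\<lambda>v. h (\<iota> v)) \<in> regular_at (affine_space r) 0"
        using regular_at_pullback[OF \<iota>, of 0 h] True zero_affine \<iota>0 by simp
      then have R: "differential (total E) \<iota> 0 D' h = D (\<lambda>e. h (\<iota> (\<xi> e)))"
        using True by (simp add: differential_def \<iota>0 D'_def \<xi>e comp_def)
      have "(\<lambda>e. h (\<iota> (\<xi> e))) \<in> regular_at ?EU ?e"
        using regular_at_pullback[OF morphism_compose[OF \<xi> \<iota>], of ?e h] eEU True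
        unfolding pEU \<xi>e \<iota>0 by blast
      then have r: "(\<lambda>e. h (\<iota> (\<xi> e))) \<in> regular_at (total E) ?e"
        unfolding regular_at_restrict[OF space_with_functions_total EUo eEU] .
      let ?k = "cscale (-1) (\<lambda>e. h (\<iota> (\<xi> e)))"
      have k: "?k \<in> regular_at (total E) ?e" by (rule regular_at_scale[OF space_with_functions_total r])
      obtain W where W: "openin (zar (total E)) W" "?e \<in> W" "h \<in> reg (total E) W" "?k \<in> reg (total E) W"
        using regular_at_common[OF space_with_functions_total True k] .
      have "h z + ?k z = 0" if "z \<in> W \<inter> fibre E y" for z
        using framing_of_coords[OF F y, of z] that by (simp add: \<iota>_def cscale_def)
      then have "D (\<lambda>z. h z + ?k z) = 0"
        using D reg_add[OF space_with_functions_total W(1,3,4)] W(1,2) unfolding tangent_to_def by blast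
      then have "D h = D (\<lambda>e. h (\<iota> (\<xi> e)))"
        using tangent_add[OF DT True k] tangent_scale[OF DT r, of "-1"] by simp
      then show ?thesis using R by simp
    qed
  qed
  then show ?thesis using that D' unfolding \<iota>_def by blast
qed

text \<open>
  The finite set \<open>B\<close> is a basis of the fibre, given by a frame. A tangent vector to the fibre is
  a linear combination of the velocities of \<open>t \<mapsto> t e\<close> with \<open>e \<in> B\<close>, and the spray maps these curves
  to \<open>t \<mapsto> s (t e)\<close>.
\<close>

lemma spray_differential_spanned_by_velocities:
  assumes y: "y \<in> points Y" and s: "morphism (total E) Y s" and s0: "s (bzero E y) = y"
  obtains B where "finite B" "B \<subseteq> fibre E y"
    "\<And>e. e \<in> B \<Longrightarrow> velocity Y y (\<lambda>t. s (bscale E t e)) \<in> tangent_space Y y"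
    "\<And>D. D \<in> tangent_to (total E) (fibre E y) (bzero E y) \<Longrightarrow>
      differential Y s (bzero E y) D \<in> cfun.span ((\<lambda>e. velocity Y y (\<lambda>t. s (bscale E t e))) ` B)"
proof -
  obtain U r \<xi> \<psi> where yU: "y \<in> U" and F: "framing Y E U r \<xi> \<psi>" using exists_framing[OF y] .
  note A = space_with_functions_affine_space
  define \<iota> where "\<iota> v = \<psi> (y, v)" for v
  have \<iota>: "morphism (affine_space r) (total E) \<iota>"
    unfolding \<iota>_def
    by (rule framing_fibre_morphism[OF F yU])
  have \<iota>_fibre: "\<iota> v \<in> fibre E y" if "v \<in> affine_points r" for v
    unfolding \<iota>_def by (rule framing_in_fibre[OF F yU that])
  have \<iota>0: "\<iota> 0 = bzero E y"
    using framing_of_coords[OF F yU bzero_in_fibre[OF y]] framing_bzero[OF F yU] by (simp add: \<iota>_def)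
  have unit: "unit_vec i \<in> affine_points r" if "i < r" for i
    using that by (auto simp: unit_vec_def affine_points_def)
  have ray: "\<iota> (cscale t (unit_vec i)) = bscale E t (\<iota> (unit_vec i))" if i: "i < r" for i t
  proof (rule framing_eqI[OF F yU \<iota>_fibre[OF unit_vec_affine[OF i]] bscale_in_fibre[OF \<iota>_fibre[OF unit[OF i]]]])
    show "\<xi> (\<iota> (cscale t (unit_vec i))) = \<xi> (bscale E t (\<iota> (unit_vec i)))"
      by (simp add: framing_bscale[OF F yU \<iota>_fibre[OF unit[OF i]]])
        (simp add: \<iota>_def framing_coords[OF F yU] unit[OF i] unit_vec_affine[OF i])
  qed
  have s\<iota>: "morphism (affine_space r) Y (\<lambda>v. s (\<iota> v))" by (rule morphism_compose[OF \<iota> s])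
  have s\<iota>0: "s (\<iota> 0) = y" by (simp add: \<iota>0 s0)
  define w where "w e = velocity Y y (\<lambda>t. s (bscale E t e))" for e
  have w: "differential Y (\<lambda>v. s (\<iota> v)) 0 (velocity (affine_space r) 0 (\<lambda>t. cscale t (unit_vec i)))
      = w (\<iota> (unit_vec i))" if i: "i < r" for i
  proof -
    have "cscale 0 (unit_vec i) = 0" by (simp add: cscale_def zero_fun_def)
    from differential_velocity[OF s\<iota>, of "\<lambda>t. cscale t (unit_vec i)" 0] this
    show ?thesis by (simp add: zero_affine s\<iota>0 w_def ray[OF i])
  qed
  show ?thesis
  proof (rule that[of "(\<lambda>i. \<iota> (unit_vec i)) ` {..<r}"])
    show "finite ((\<lambda>i. \<iota> (unit_vec i)) ` {..<r})" by simp
    show "(\<lambda>i. \<iota> (unit_vec i)) ` {..<r} \<subseteq> fibre E y" using \<iota>_fibre unit by auto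
    fix e assume "e \<in> (\<lambda>i. \<iota> (unit_vec i)) ` {..<r}"
    then obtain i where i: "i < r" "e = \<iota> (unit_vec i)" by auto
    have "differential Y (\<lambda>v. s (\<iota> v)) 0 (velocity (affine_space r) 0 (\<lambda>t. cscale t (unit_vec i)))
      \<in> tangent_space Y (s (\<iota> 0))"
      by (rule differential_tangent[OF Y s\<iota>]) (simp_all add: zero_affine velocity_ray_tangent unit i)
    then show "velocity Y y (\<lambda>t. s (bscale E t e)) \<in> tangent_space Y y"
      by (simp add: w i s\<iota>0 flip: w_def)
  next
    fix D assume "D \<in> tangent_to (total E) (fibre E y) (bzero E y)"
    then obtain D' where D': "D' \<in> tangent_space (affine_space r) 0" "D = differential (total E) \<iota> 0 D'"
      using tangent_to_fibre_from_affine_space[OF yU F] unfolding \<iota>_def by metis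
    have "\<iota> 0 \<in> points (total E)" by (rule fibreD(1)[OF \<iota>_fibre[OF zero_affine]])
    from differential_compose[where f = \<iota> and x = 0, OF s this, of D'] D'
    have "differential Y s (bzero E y) D = differential Y (\<lambda>v. s (\<iota> v)) 0 D'" by (simp add: \<iota>0)
    also have "\<dots> = (\<Sum>i<r. cscale (D' (\<lambda>z. z i)) (differential Y (\<lambda>v. s (\<iota> v)) 0
        (velocity (affine_space r) 0 (\<lambda>t. cscale t (unit_vec i)))))"
      unfolding differential_sum[symmetric] tangent_affine_space_expansion[OF D'(1), symmetric] ..
    also have "\<dots> = (\<Sum>i<r. cscale (D' (\<lambda>z. z i)) (w (\<iota> (unit_vec i))))"
      by (rule sum.cong) (simp_all add: w)
    also have "\<dots> \<in> cfun.span (w ` (\<lambda>i. \<iota> (unit_vec i)) ` {..<r})"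
      by (intro cfun.span_sum cfun.span_scale cfun.span_base) auto
    finally show "differential Y s (bzero E y) D
      \<in> cfun.span ((\<lambda>e. velocity Y y (\<lambda>t. s (bscale E t e))) ` (\<lambda>i. \<iota> (unit_vec i)) ` {..<r})"
      unfolding w_def .
  qed
qed

text \<open>
  Take a section \<open>\<sigma>\<close> along \<open>f\<close> with \<open>\<sigma> 0 = e\<close> and let \<open>g\<close> map \<open>z\<close> to the spray value at
  \<open>z k * \<sigma> (z(k := 0))\<close>. On the hyperplane \<open>z k = 0\<close> the spray is applied to zero vectors only, so \<open>g\<close>
  agrees with \<open>f\<close> there. On the axis \<open>k\<close> the argument of the section is the origin, so \<open>g\<close> runs along
  \<open>t \<mapsto> s (t e)\<close>.
\<close>

lemma prescribe_map_on_axis: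
  assumes s: "morphism (total E) Y s" and s0: "\<And>y. y \<in> points Y \<Longrightarrow> s (bzero E y) = y"
    and f: "morphism (affine_space n) Y f" and e: "e \<in> fibre E (f 0)" and k: "k < n"
  obtains g where "morphism (affine_space n) Y g" "g 0 = f 0"
    "\<And>t. g (cscale t (unit_vec k)) = s (bscale E t e)"
    "\<And>i t. i < n \<Longrightarrow> i \<noteq> k \<Longrightarrow> g (cscale t (unit_vec i)) = f (cscale t (unit_vec i))"
proof -
  note A = space_with_functions_affine_space[of n]
  obtain \<sigma> where \<sigma>: "morphism (affine_space n) (total E) \<sigma>"
    and over: "\<And>z. z \<in> affine_points n \<Longrightarrow> proj E (\<sigma> z) = f z" and \<sigma>0: "\<sigma> 0 = e"
    using exists_section_through[OF f e] by blast
  have "morphism (affine_space n) (affine_space n) (\<lambda>z. z(k := 0))"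
  proof (rule morphism_into_affine_space[OF A])
    fix i assume "i < n"
    then have "(\<lambda>z. (z(k := 0)) i) \<in> poly_fun n" by (cases "i = k") (auto intro: poly_fun.const poly_fun.coord)
    then show "(\<lambda>z. (z(k := 0)) i) \<in> reg (affine_space n) (points (affine_space n))"
      by (intro poly_fun_reg_affine_space openin_topspace)
  qed (simp add: affine_points_def)
  from morphism_compose[OF this \<sigma>]
  have \<sigma>k: "morphism (affine_space n) (total E) (\<lambda>z. \<sigma> (z(k := 0)))" .
  have zk: "(\<lambda>z. z k) \<in> reg (affine_space n) (points (affine_space n))"
    by (intro poly_fun_reg_affine_space openin_topspace poly_fun.coord k)
  have g: "morphism (affine_space n) Y (\<lambda>z. s (bscale E (z k) (\<sigma> (z(k := 0)))))"
    by (rule morphism_compose[OF morphism_bscale[OF A \<sigma>k zk] s])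
  have gk: "s (bscale E (z k) (\<sigma> (z(k := 0)))) = f z" if z: "z \<in> affine_points n" "z k = 0" for z
  proof -
    have "z(k := 0) = z" using z(2) by auto
    moreover have "\<sigma> z \<in> points (total E)" using morphism_points[OF \<sigma>, of z] z by simp
    then have "\<sigma> z \<in> fibre E (f z)" using over[OF z(1)] in_fibre_proj[of "\<sigma> z"] by simp
    ultimately show ?thesis using z(2) s0[OF fibre_base] by (simp add: bscale_zero)
  qed
  show ?thesis
  proof (rule that[OF g])
    show "s (bscale E ((0::nat \<Rightarrow> complex) k) (\<sigma> (0(k := 0)))) = f 0"
      by (rule gk[OF zero_affine]) simp
    show "s (bscale E (cscale t (unit_vec k) k) (\<sigma> ((cscale t (unit_vec k))(k := 0)))) = s (bscale E t e)" for t
    proof -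
      have "(cscale t (unit_vec k))(k := 0) = 0" by (auto simp: cscale_def unit_vec_def)
      then show ?thesis by (simp add: \<sigma>0 cscale_def unit_vec_def)
    qed
    show "s (bscale E (cscale t (unit_vec i) k) (\<sigma> ((cscale t (unit_vec i))(k := 0)))) = f (cscale t (unit_vec i))"
      if "i < n" "i \<noteq> k" for i t
      by (rule gk) (use that in \<open>auto simp: affine_points_def cscale_def unit_vec_def\<close>)
  qed
qed

end

section \<open>From the sprays to a dominating map\<close>


text \<open>
  The tangent space of affine space has the velocities of the coordinate axes as a basis, and the
  differential sends them to the velocities of the images of the axes.
\<close>

lemma bij_betw_differential_of_basis:
  assumes Y: "space_with_functions Y" and f: "morphism (affine_space n) Y f"
    and w: "\<And>i. i < n \<Longrightarrow> velocity Y (f 0) (\<lambda>t. f (cscale t (unit_vec i))) = w i"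
    and inj: "inj_on w {..<n}" and indep: "cfun.independent (w ` {..<n})"
    and span: "cfun.span (w ` {..<n}) = tangent_space Y (f 0)"
  shows "bij_betw (differential Y f 0) (tangent_space (affine_space n) 0) (tangent_space Y (f 0))"
proof -
  let ?T = "tangent_space (affine_space n) 0" and ?d = "differential Y f 0"
  let ?u = "\<lambda>i. velocity (affine_space n) 0 (\<lambda>t. cscale t (unit_vec i))"
  have dw: "?d (?u i) = w i" if "i < n" for i
  proof -
    have "cscale 0 (unit_vec i) = 0" by (simp add: cscale_def zero_fun_def)
    then show ?thesis
      using differential_velocity[OF f, of "\<lambda>t. cscale t (unit_vec i)" 0] w[OF that] by (simp add: zero_affine)
  qed
  have d: "?d (\<Sum>i<n. cscale (a i) (?u i)) = (\<Sum>i<n. cscale (a i) (w i))" for a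
    unfolding differential_sum by (rule sum.cong) (simp_all add: dw)
  show ?thesis
    unfolding bij_betw_def
  proof (intro conjI inj_onI equalityI subsetI)
    fix D D' assume D: "D \<in> ?T" and D': "D' \<in> ?T" and eq: "?d D = ?d D'"
    let ?a = "\<lambda>i. D (\<lambda>z. z i) - D' (\<lambda>z. z i)"
    have "(\<Sum>i<n. cscale (D (\<lambda>z. z i)) (w i)) = (\<Sum>i<n. cscale (D' (\<lambda>z. z i)) (w i))"
      using eq unfolding d[symmetric] tangent_affine_space_expansion[OF D, symmetric]
        tangent_affine_space_expansion[OF D', symmetric] .
    then have "(\<Sum>i<n. cscale (?a i) (w i)) = 0"
      by (simp add: cfun.scale_left_diff_distrib sum_subtractf)
    \<comment> \<open>Linear independence of a set is about coefficients indexed by its elements, hence the reindexing.\<close>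
    moreover define b where "b v = ?a (inv_into {..<n} w v)" for v
    ultimately have "(\<Sum>v\<in>w ` {..<n}. cscale (b v) v) = 0"
      by (simp add: sum.reindex[OF inj] inv_into_f_f[OF inj])
    from cfun.independentD[OF indep finite_imageI[OF finite_lessThan] subset_refl this]
    have "b (w i) = 0" if "i < n" for i using that by simp
    then have "?a i = 0" if "i < n" for i
      using inv_into_f_f[OF inj, of i] that unfolding b_def by (metis lessThan_iff)
    then show "D = D'"
      by (intro tangent_affine_space_eqI[OF D D']) simp
  next
    fix v assume "v \<in> ?d ` ?T"
    then show "v \<in> tangent_space Y (f 0)" using differential_tangent[OF Y f] by (auto simp: zero_affine)
  next
    fix v assume "v \<in> tangent_space Y (f 0)"
    then have "v \<in> cfun.span (w ` {..<n})" by (simp add: span)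
    then obtain a where "v = (\<Sum>b\<in>w ` {..<n}. cscale (a b) b)"
      unfolding cfun.span_finite[OF finite_imageI[OF finite_lessThan]] by blast
    then have v: "v = ?d (\<Sum>i<n. cscale (a (w i)) (?u i))" by (simp add: d sum.reindex[OF inj])
    have "(\<Sum>i<n. cscale (a (w i)) (?u i)) \<in> ?T"
    proof (intro cfun.subspace_sum[OF subspace_tangent_space] cfun.subspace_scale[OF subspace_tangent_space]
        velocity_ray_tangent)
      fix i assume "i \<in> {..<n}"
      then show "unit_vec i \<in> affine_points n" by (auto simp: unit_vec_def affine_points_def)
    qed
    then show "v \<in> ?d ` ?T" unfolding v by (rule imageI)
  qed
qed

text \<open>
  The images of the fibres span the tangent space and each of them is spanned by velocities of curves
  \<open>t \<mapsto> s (t e)\<close>, so some of these velocities form a basis. Its size is the local dimension by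
  smoothness. A map \<open>f\<close> that follows these curves on the coordinate axes is built up one axis at a time.
\<close>

theorem proposition6:
  fixes X :: "'a fspace"
  assumes "algebraic_manifold X"
    and "algebraically_subelliptic TYPE('e) X"
  shows "strongly_algebraically_dominable X"
  unfolding strongly_algebraically_dominable_def
proof
  fix x assume x: "x \<in> points X"
  have smooth: "smooth_variety X" using assms(1) by (simp add: algebraic_manifold_def)
  have X: "space_with_functions X" using smooth by (simp add: smooth_variety_def algebraic_variety_def)
  obtain m and E :: "nat \<Rightarrow> ('e, 'a) vbundle" and s
    where spray: "\<And>j. j < m \<Longrightarrow> algebraic_spray X (E j) (s j)" and dom: "dominating_family X m E s"
    using assms(2) unfolding algebraically_subelliptic_def by blast
  have VB: "vector_bundle X (E j)" and s: "morphism (total (E j)) X (s j)"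
    and s0: "\<And>y. y \<in> points X \<Longrightarrow> s j (bzero (E j) y) = y" if "j < m" for j
    using spray[OF that] X unfolding algebraic_spray_def vector_bundle_def by blast+
  let ?T = "tangent_space X x"
  define vel where "vel j e = velocity X x (\<lambda>t. s j (bscale (E j) t e))" for j e
  have "\<forall>j. \<exists>B. j < m \<longrightarrow> finite B \<and> B \<subseteq> fibre (E j) x \<and> vel j ` B \<subseteq> ?T \<and>
      (\<forall>D\<in>tangent_to (total (E j)) (fibre (E j) x) (bzero (E j) x).
         differential X (s j) (bzero (E j) x) D \<in> cfun.span (vel j ` B))"
  proof
    fix j
    show "\<exists>B. j < m \<longrightarrow> finite B \<and> B \<subseteq> fibre (E j) x \<and> vel j ` B \<subseteq> ?T \<and>
      (\<forall>D\<in>tangent_to (total (E j)) (fibre (E j) x) (bzero (E j) x).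
         differential X (s j) (bzero (E j) x) D \<in> cfun.span (vel j ` B))"
    proof (cases "j < m")
      case True
      show ?thesis
        by (rule vector_bundle.spray_differential_spanned_by_velocities[OF VB[OF True] x s[OF True] s0[OF True x]],
            fold vel_def) blast
    qed simp
  qed
  from this[unfolded choice_iff]
  obtain B where BB: "\<forall>j. j < m \<longrightarrow> finite (B j) \<and> B j \<subseteq> fibre (E j) x \<and> vel j ` B j \<subseteq> ?T \<and>
      (\<forall>D\<in>tangent_to (total (E j)) (fibre (E j) x) (bzero (E j) x).
         differential X (s j) (bzero (E j) x) D \<in> cfun.span (vel j ` B j))" ..
  have B: "finite (B j)" "B j \<subseteq> fibre (E j) x" "vel j ` B j \<subseteq> ?T"
    "\<And>D. D \<in> tangent_to (total (E j)) (fibre (E j) x) (bzero (E j) x) \<Longrightarrow>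
       differential X (s j) (bzero (E j) x) D \<in> cfun.span (vel j ` B j)" if "j < m" for j
    using BB[rule_format, OF that] by simp_all
  define W where "W = (\<Union>j<m. vel j ` B j)"
  have W: "W \<subseteq> ?T" using B(3) by (auto simp: W_def)
  have TW: "?T \<subseteq> cfun.span W"
  proof
    fix v assume "v \<in> ?T"
    then obtain u where u: "v = (\<Sum>j<m. u j)" "\<And>j. j < m \<Longrightarrow> u j \<in> differential X (s j) (bzero (E j) x) `
            tangent_to (total (E j)) (fibre (E j) x) (bzero (E j) x)"
      using dom x unfolding dominating_family_def by blast
    show "v \<in> cfun.span W" unfolding u(1)
    proof (rule cfun.span_sum)
      fix j assume "j \<in> {..<m}"
      then have j: "j < m" by simp
      then have "u j \<in> cfun.span (vel j ` B j)" using u(2)[OF j] B(4)[OF j] by auto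
      moreover have "vel j ` B j \<subseteq> W" using j by (auto simp: W_def)
      ultimately show "u j \<in> cfun.span W" using cfun.span_mono by blast
    qed
  qed
  obtain C where C: "C \<subseteq> W" "cfun.independent C" "W \<subseteq> cfun.span C"
    using cfun.maximal_independent_subset .
  have "finite W" using B(1) by (simp add: W_def)
  then have finC: "finite C" using C(1) finite_subset by blast
  have TC: "?T \<subseteq> cfun.span C"
    using TW cfun.span_minimal[OF C(3) cfun.subspace_span] by blast
  have spanC: "cfun.span C = ?T"
    by (rule cfun.span_subspace[OF _ TC subspace_tangent_space]) (use C W in blast)
  define n where "n = card C"
  have "cfun.dim ?T = n" unfolding n_def using cfun.basis_card_eq_dim[OF _ TC C(2)] C(1) W by auto
  then have dim: "enat n = dim_at X x" using smooth x unfolding smooth_variety_def by metis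
  obtain w where w: "bij_betw w {..<n} C"
    using ex_bij_betw_nat_finite[OF finC] unfolding n_def atLeast0LessThan by blast
  have wC: "w i \<in> C" if "i < n" for i using w that by (auto simp: bij_betw_def)
  have "\<forall>i. \<exists>j e. i < n \<longrightarrow> j < m \<and> e \<in> fibre (E j) x \<and> w i = vel j e"
  proof
    fix i
    show "\<exists>j e. i < n \<longrightarrow> j < m \<and> e \<in> fibre (E j) x \<and> w i = vel j e"
    proof (cases "i < n")
      case True
      then have "w i \<in> W" using wC C(1) by blast
      then show ?thesis using B(2) unfolding W_def by blast
    qed simp
  qed
  from this[unfolded choice_iff]
  obtain j e where je': "\<forall>i. i < n \<longrightarrow> j i < m \<and> e i \<in> fibre (E (j i)) x \<and> w i = vel (j i) (e i)"
    by blast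
  have je: "j i < m" "e i \<in> fibre (E (j i)) x" "w i = vel (j i) (e i)" if "i < n" for i
    using je'[rule_format, OF that] by simp_all
  have "k \<le> n \<Longrightarrow> \<exists>f. morphism (affine_space n) X f \<and> f 0 = x \<and>
      (\<forall>i<k. \<forall>t. f (cscale t (unit_vec i)) = s (j i) (bscale (E (j i)) t (e i)))" for k
  proof (induction k)
    case 0
    show ?case
      using morphism_const[OF space_with_functions_affine_space x] by (intro exI[of _ "\<lambda>_. x"]) simp
  next
    case (Suc k)
    from Suc.IH[OF Suc_leD[OF Suc.prems]]
    obtain f where f: "morphism (affine_space n) X f" "f 0 = x"
      "\<And>i t. i < k \<Longrightarrow> f (cscale t (unit_vec i)) = s (j i) (bscale (E (j i)) t (e i))" by blast
    have k: "k < n" using Suc.prems by simp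
    have ek: "e k \<in> fibre (E (j k)) (f 0)" using je(2)[OF k] f(2) by simp
    obtain g where g: "morphism (affine_space n) X g" "g 0 = f 0"
      "\<And>t. g (cscale t (unit_vec k)) = s (j k) (bscale (E (j k)) t (e k))"
      "\<And>i t. i < n \<Longrightarrow> i \<noteq> k \<Longrightarrow> g (cscale t (unit_vec i)) = f (cscale t (unit_vec i))"
      using vector_bundle.prescribe_map_on_axis[OF VB[OF je(1)[OF k]] s[OF je(1)[OF k]] s0[OF je(1)[OF k]]
          f(1) ek k] by blast
    show ?case
    proof (intro exI[of _ g] conjI allI impI)
      fix i t assume "i < Suc k"
      then show "g (cscale t (unit_vec i)) = s (j i) (bscale (E (j i)) t (e i))"
        using g(3,4) f(3) k by (cases "i = k") auto
    qed (rule g(1), rule trans[OF g(2) f(2)])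
  qed
  then obtain f where f: "morphism (affine_space n) X f" "f 0 = x"
    "\<And>i t. i < n \<Longrightarrow> f (cscale t (unit_vec i)) = s (j i) (bscale (E (j i)) t (e i))" by blast
  have "bij_betw (differential X f 0) (tangent_space (affine_space n) 0) (tangent_space X (f 0))"
  proof (rule bij_betw_differential_of_basis[OF X f(1)])
    show "velocity X (f 0) (\<lambda>t. f (cscale t (unit_vec i))) = w i" if "i < n" for i
      using je(3)[OF that] f(2,3) that by (simp add: vel_def)
  qed (use w C(2) spanC f(2) in \<open>simp_all add: bij_betw_def\<close>)
  then show "algebraically_dominable_at X x"
    unfolding algebraically_dominable_at_def f(2) using dim f(1,2) by blast
qed

end
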